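(* Let $p$ be a prime, $W$ a $p$-adically complete ring and $R=W[[q-1]]$. The flip map of $R[[\xi]]$ extends uniquely to a continuous semilinear (with respect to $\theta$) automorphism $\tau$ of the ring $\widehat{R\langle\omega\rangle}_{\mathbb{\Delta}}$, and we have $\tau\circ\tau=\mathrm{Id}_{\widehat{R\langle\omega\rangle}_{\mathbb{\Delta}}}$.
   Context: $(n)_q=1+q+\cdots+q^{n-1}$; $(n)_{q^p}$, $\binom nk_{q^p}$ are Gaussian integers and binomials at $q^p$. $R\langle\omega\rangle_{\mathbb{\Delta}}$ is the commutative $R$-algebra free as a module on $(\omega^{\{n\}_{\mathbb{\Delta}}})_{n\in\mathbb N}$, with unit $\omega^{\{0\}_{\mathbb{\Delta}}}$, $\omega:=\omega^{\{1\}_{\mathbb{\Delta}}}$ and $$\omega^{\{n_1\}_{\mathbb{\Delta}}}\omega^{\{n_2\}_{\mathbb{\Delta}}}=\sum_{0\le i\le\min(n_1,n_2)}q^{\frac{pi(i-1)}2}\binom{n_1+n_2-i}{n_1}_{q^p}\binom{n_1}{i}_{q^p}(q-1)^iq^i\,\omega^{\{n_1+n_2-i\}_{\mathbb{\Delta}}};$$ $\widehat{R\langle\omega\rangle}_{\mathbb{\Delta}}$ is its $(p,q-1)$-adic completion. There is a canonical continuous $R$-algebra morphism $R[[\xi]]\to\widehat{R\langle\omega\rangle}_{\mathbb{\Delta}}$, $\xi\mapsto(p)_q\omega$; "extends" is with respect to this map. The Taylor map $\theta:R\to\widehat{R\langle\omega\rangle}_{\mathbb{\Delta}}$ is the unique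 continuous $W$-algebra morphism with $\theta(q)=q+(p)_q\omega$. The flip map of $R[[\xi]]$ is the continuous $W$-algebra automorphism with $q\mapsto q+\xi$ and $\xi\mapsto-\xi$. Semilinear with respect to $\theta$ means $\tau(\alpha\varphi)=\theta(\alpha)\tau(\varphi)$ for $\alpha\in R$. *)

theory Defs
  imports
    "HOL-Computational_Algebra.Formal_Power_Series"
    "HOL-Computational_Algebra.Primes"
    "HOL-Library.Set_Algebras"
begin

definition is_ring_hom :: "('a::comm_ring_1 \<Rightarrow> 'b::comm_ring_1) \<Rightarrow> bool" where
  "is_ring_hom f \<longleftrightarrow>
     f 1 = 1 \<and> (\<forall>x y. f (x + y) = f x + f y) \<and> (\<forall>x y. f (x * y) = f x * f y)"

definition ideal_gen :: "'a::comm_ring_1 set \<Rightarrow> 'a set" where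
  "ideal_gen S = module.span (*) S"

fun ideal_power :: "'a::comm_ring_1 set \<Rightarrow> nat \<Rightarrow> 'a set" where
  "ideal_power I 0 = UNIV"
| "ideal_power I (Suc n) = ideal_gen {a * b | a b. a \<in> I \<and> b \<in> ideal_power I n}"


(* The elements of the inverse limit of the rings A/I^n. An element of A/I^n is a coset, and the
   coset x (Suc n) of I^(n+1) is sent to the coset x n by A/I^(n+1) -> A/I^n iff it is contained
   in it. *)
definition adic_limit :: "'a::comm_ring_1 set \<Rightarrow> (nat \<Rightarrow> 'a set) set" where
  "adic_limit I =
     {x. (\<forall>n. \<exists>a. x n = a +o ideal_power I n) \<and> (\<forall>n. x (Suc n) \<subseteq> x n)}"

(* Complete includes separated. *)
definition adic_complete :: "'a::comm_ring_1 set \<Rightarrow> bool" where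
  "adic_complete I \<longleftrightarrow> bij_betw (\<lambda>a n. a +o ideal_power I n) UNIV (adic_limit I)"

(* The maps pr n : H -> A/I^n identify the ring H with the inverse limit of the A/I^n, and iota is
   the resulting map A -> H. The sum of two cosets as sets is their sum in A/I^n, while
   their product as sets is only contained in their product in A/I^n. *)
definition adic_completion ::
  "'a::comm_ring_1 set \<Rightarrow> ('a \<Rightarrow> 'h::comm_ring_1) \<Rightarrow> (nat \<Rightarrow> 'h \<Rightarrow> 'a set) \<Rightarrow> bool" where
  "adic_completion I \<iota> pr \<longleftrightarrow>
     bij_betw (\<lambda>h n. pr n h) UNIV (adic_limit I) \<and>
     (\<forall>n. pr n 1 = 1 +o ideal_power I n) \<and>
     (\<forall>n x y. pr n (x + y) = pr n x + pr n y) \<and>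
     (\<forall>n x y. pr n x * pr n y \<subseteq> pr n (x * y)) \<and>
     (\<forall>n a. pr n (\<iota> a) = a +o ideal_power I n)"

(* Fundamental neighbourhoods of 0 for the inverse limit topology, each A/I^n being discrete. *)
definition limit_nbhd :: "(nat \<Rightarrow> 'h::comm_ring_1 \<Rightarrow> 'a set) \<Rightarrow> nat \<Rightarrow> 'h set" where
  "limit_nbhd pr n = {h. pr n h = pr n 0}"

(* Continuity at every point, for the additive group topologies in which the sets F m,
   respectively G n, form a basis of neighbourhoods of 0. *)
definition filt_continuous ::
  "(nat \<Rightarrow> 'a::comm_ring_1 set) \<Rightarrow> (nat \<Rightarrow> 'b::comm_ring_1 set) \<Rightarrow> ('a \<Rightarrow> 'b) \<Rightarrow> bool" where
  "filt_continuous F G f \<longleftrightarrow>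
     (\<forall>x n. \<exists>m. \<forall>y. y - x \<in> F m \<longrightarrow> f y - f x \<in> G n)"


definition q_int :: "'a::comm_ring_1 \<Rightarrow> nat \<Rightarrow> 'a" where
  "q_int t n = (\<Sum>i<n. t ^ i)"

fun q_binomial :: "'a::comm_ring_1 \<Rightarrow> nat \<Rightarrow> nat \<Rightarrow> 'a" where
  "q_binomial t n 0 = 1"
| "q_binomial t 0 (Suc k) = 0"
| "q_binomial t (Suc n) (Suc k) = q_binomial t n k + t ^ Suc k * q_binomial t n (Suc k)"

(* R = W[[q-1]] is the type 'w fps, whose variable fps_X is q - 1. Accordingly R[[xi]] is
   'w fps fps, with xi = fps_X; its elements from R are fps_const r and those from W are
   fps_const (fps_const a). *)
definition qv :: "'w::comm_ring_1 fps" where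
  "qv = 1 + fps_X"

definition base_nbhd :: "nat \<Rightarrow> nat \<Rightarrow> 'w::comm_ring_1 fps set" where
  "base_nbhd p = ideal_power (ideal_gen {of_nat p, qv - 1})"

(* xi has to be part of the ideal: q -> q + xi is not continuous for the (p, q - 1)-adic topology. *)
definition xi_nbhd :: "nat \<Rightarrow> nat \<Rightarrow> 'w::comm_ring_1 fps fps set" where
  "xi_nbhd p = ideal_power (ideal_gen {of_nat p, fps_const (qv - 1), fps_X})"

(* The R-algebra R<omega>, with structure map s : R -> A and with w n the n-th twisted divided
   power of omega. The three clauses after the structure map say that the w n form a basis of A as
   an R-module, that w 0 is the unit, and how basis elements are multiplied. *)
definition twisted_dp_algebra ::
  "nat \<Rightarrow> ('w::comm_ring_1 fps \<Rightarrow> 'a::comm_ring_1) \<Rightarrow> (nat \<Rightarrow> 'a) \<Rightarrow> bool" where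
  "twisted_dp_algebra p s w \<longleftrightarrow>
     is_ring_hom s \<and>
     (\<forall>a. \<exists>!c. finite {n. c n \<noteq> 0} \<and> a = (\<Sum>n | c n \<noteq> 0. s (c n) * w n)) \<and>
     w 0 = 1 \<and>
     (\<forall>n1 n2. w n1 * w n2 =
        (\<Sum>i\<le>min n1 n2.
           s (qv ^ (p * i * (i - 1) div 2)
              * q_binomial (qv ^ p) (n1 + n2 - i) n1 * q_binomial (qv ^ p) n1 i
              * (qv - 1) ^ i * qv ^ i)
           * w (n1 + n2 - i)))"

definition canonical_map ::
  "nat \<Rightarrow> ('w::comm_ring_1 fps \<Rightarrow> 'a::comm_ring_1) \<Rightarrow> (nat \<Rightarrow> 'a) \<Rightarrow>
   ('a \<Rightarrow> 'h::comm_ring_1) \<Rightarrow> (nat \<Rightarrow> 'h \<Rightarrow> 'a set) \<Rightarrow> ('w fps fps \<Rightarrow> 'h) \<Rightarrow> bool" where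
  "canonical_map p s w \<iota> pr \<kappa> \<longleftrightarrow>
     is_ring_hom \<kappa> \<and> filt_continuous (xi_nbhd p) (limit_nbhd pr) \<kappa> \<and>
     (\<forall>r. \<kappa> (fps_const r) = \<iota> (s r)) \<and>
     \<kappa> fps_X = \<iota> (s (q_int qv p) * w 1)"

definition taylor_map ::
  "nat \<Rightarrow> ('w::comm_ring_1 fps \<Rightarrow> 'a::comm_ring_1) \<Rightarrow> (nat \<Rightarrow> 'a) \<Rightarrow>
   ('a \<Rightarrow> 'h::comm_ring_1) \<Rightarrow> (nat \<Rightarrow> 'h \<Rightarrow> 'a set) \<Rightarrow> ('w fps \<Rightarrow> 'h) \<Rightarrow> bool" where
  "taylor_map p s w \<iota> pr \<theta> \<longleftrightarrow>
     is_ring_hom \<theta> \<and> filt_continuous (base_nbhd p) (limit_nbhd pr) \<theta> \<and>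
     (\<forall>a. \<theta> (fps_const a) = \<iota> (s (fps_const a))) \<and>
     \<theta> qv = \<iota> (s qv + s (q_int qv p) * w 1)"

definition flip_map :: "nat \<Rightarrow> ('w::comm_ring_1 fps fps \<Rightarrow> 'w fps fps) \<Rightarrow> bool" where
  "flip_map p f \<longleftrightarrow>
     is_ring_hom f \<and> bij f \<and> filt_continuous (xi_nbhd p) (xi_nbhd p) f \<and>
     (\<forall>a. f (fps_const (fps_const a)) = fps_const (fps_const a)) \<and>
     f (fps_const qv) = fps_const qv + fps_X \<and>
     f fps_X = - fps_X"

definition flip_extension ::
  "('w::comm_ring_1 fps \<Rightarrow> 'a::comm_ring_1) \<Rightarrow> ('a \<Rightarrow> 'h::comm_ring_1) \<Rightarrow>
   (nat \<Rightarrow> 'h \<Rightarrow> 'a set) \<Rightarrow> ('w fps fps \<Rightarrow> 'h) \<Rightarrow> ('w fps \<Rightarrow> 'h) \<Rightarrow>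
   ('w fps fps \<Rightarrow> 'w fps fps) \<Rightarrow> ('h \<Rightarrow> 'h) \<Rightarrow> bool" where
  "flip_extension s \<iota> pr \<kappa> \<theta> flip \<tau> \<longleftrightarrow>
     is_ring_hom \<tau> \<and> bij \<tau> \<and> filt_continuous (limit_nbhd pr) (limit_nbhd pr) \<tau> \<and>
     (\<forall>\<alpha> \<phi>. \<tau> (\<iota> (s \<alpha>) * \<phi>) = \<theta> \<alpha> * \<tau> \<phi>) \<and>
     (\<forall>f. \<tau> (\<kappa> f) = \<kappa> (flip f))"

end

theory Submission
  imports Defs "HOL-Number_Theory.Cong"
begin

text \<open>
  Write \<open>q' = q + (p)\<^sub>q\<omega>\<close> and \<open>a\<^sub>n = (p)\<^sub>q\<^sup>n (n)!\<close>, the factorial being taken at \<open>q\<^sup>p\<close>, so that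
  \<open>a\<^sub>n \<omega>\<^bsup>{n}\<^esup> = \<Prod>\<^bsub>k<n\<^esub> (q' - q\<^bsup>pk+1\<^esup>)\<close>. The flip must send \<open>\<omega>\<^bsup>{n}\<^esup>\<close> to the quotient of
  \<open>E\<^sub>n = \<Prod>\<^bsub>k<n\<^esub> (q - q'\<^bsup>pk+1\<^esup>)\<close> by \<open>\<theta>(a\<^sub>n)\<close>, and the point is that this quotient exists. At
  \<open>q' = q\<^bsup>pm+1\<^esup>\<close> the product \<open>E\<^sub>n\<close> is divisible by \<open>(q - 1)\<^sup>n b\<^sub>n\<close>, where \<open>b\<^sub>n\<close> is the part of
  \<open>a\<^sub>n\<close> made of \<open>p\<close>-power cyclotomic polynomials. Newton interpolation at these nodes over the
  torsion-free ring \<open>\<int>[[q - 1]]\<close> turns this into divisibility of \<open>E\<^sub>n\<close> by \<open>b\<^sub>n\<close> in \<open>R\<langle>\<omega>\<rangle>\<close>. In the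
  completion, \<open>a\<^sub>n\<close>, \<open>b\<^sub>n\<close> and \<open>\<theta>(a\<^sub>n)\<close> agree up to units and are regular, because
  \<open>b\<^sub>n\<close> is a power of \<open>q - 1\<close> modulo \<open>p\<close>.

  The resulting \<open>\<theta>\<close>-semilinear map intertwines multiplication by \<open>q'\<close> and by \<open>q\<close>, so
  regularity of \<open>\<theta>(a\<^sub>n)\<close> makes it multiplicative; it extends by continuity. A continuous ring
  endomorphism of the completion that fixes the image of \<open>R[[\<xi>]]\<close> is the identity, again by
  regularity of the \<open>a\<^sub>n\<close>; this gives \<open>\<tau> \<circ> \<tau> = id\<close>, bijectivity and uniqueness.
\<close>

section \<open>Ideals and adic completions\<close>

interpretation ring_module: module "(*) :: 'a::comm_ring_1 \<Rightarrow> 'a \<Rightarrow> 'a"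
  by unfold_locales (simp_all add: algebra_simps)

declare ring_module.scale_scale [simp del] \<comment> \<open>loops with \<open>mult.assoc\<close>\<close>

abbreviation is_ideal :: "'a::comm_ring_1 set \<Rightarrow> bool" where
  "is_ideal \<equiv> module.subspace (*)"

lemma ideal_mult_right: "is_ideal J \<Longrightarrow> x \<in> J \<Longrightarrow> x * c \<in> J"
  using ring_module.subspace_scale[of J x c] by (simp add: mult.commute)

lemma is_ideal_ideal_gen [simp]: "is_ideal (ideal_gen S)"
  unfolding ideal_gen_def by (rule ring_module.subspace_span)

lemma ideal_gen_base: "x \<in> S \<Longrightarrow> x \<in> ideal_gen S"
  unfolding ideal_gen_def by (rule ring_module.span_base)

lemma is_ideal_ideal_power [simp]: "is_ideal (ideal_power I n)"
  by (cases n) simp_all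

lemma ideal_power_Suc_mem: "a \<in> I \<Longrightarrow> b \<in> ideal_power I n \<Longrightarrow> a * b \<in> ideal_power I (Suc n)"
  by (auto intro: ideal_gen_base)

lemma ideal_gen_minimal: "S \<subseteq> J \<Longrightarrow> is_ideal J \<Longrightarrow> ideal_gen S \<subseteq> J"
  unfolding ideal_gen_def by (rule ring_module.span_minimal)

lemma ideal_power_Suc_subset: "ideal_power I (Suc n) \<subseteq> ideal_power I n"
  by (simp, rule ideal_gen_minimal) (auto intro: ring_module.subspace_scale)

lemma ideal_power_antimono: "m \<le> n \<Longrightarrow> ideal_power I n \<subseteq> ideal_power I m"
  by (rule lift_Suc_antimono_le[of "ideal_power I"]) (use ideal_power_Suc_subset in blast)+

lemma power_mult_mem_ideal_power: "x \<in> I \<Longrightarrow> x ^ n * y \<in> ideal_power I n"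
proof (induction n)
  case (Suc n)
  then show ?case using ideal_power_Suc_mem[of x I "x ^ n * y" n] by (simp add: mult.assoc)
qed simp

section \<open>Ideals with two generators and their powers\<close>

lemma ideal_gen_pair: "ideal_gen {u, v} = {u * y + v * z | y z. True}"
proof
  show "ideal_gen {u, v} \<subseteq> {u * y + v * z | y z. True}"
  proof (rule ideal_gen_minimal)
    have "u = u * 1 + v * 0" "v = u * 0 + v * 1"
      by simp_all
    then have "\<exists>y z. u = u * y + v * z" "\<exists>y z. v = u * y + v * z"
      by metis+
    then show "{u, v} \<subseteq> {u * y + v * z | y z. True}"
      by blast
    show "is_ideal {u * y + v * z | y z. True}"
    proof (rule ring_module.subspaceI)
      have "0 = u * 0 + v * 0"
        by simp
      then show "0 \<in> {u * y + v * z | y z. True}"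
        by blast
    next
      fix a b
      assume "a \<in> {u * y + v * z | y z. True}" "b \<in> {u * y + v * z | y z. True}"
      then obtain y z y' z' where "a = u * y + v * z" "b = u * y' + v * z'"
        by blast
      then have "a + b = u * (y + y') + v * (z + z')"
        by (simp add: algebra_simps)
      then show "a + b \<in> {u * y + v * z | y z. True}"
        by blast
    next
      fix c a
      assume "a \<in> {u * y + v * z | y z. True}"
      then obtain y z where "a = u * y + v * z"
        by blast
      then have "c * a = u * (c * y) + v * (c * z)"
        by (simp add: algebra_simps)
      then show "c * a \<in> {u * y + v * z | y z. True}"
        by blast
    qed
  qed
  show "{u * y + v * z | y z. True} \<subseteq> ideal_gen {u, v}"
    by (clarify, intro ring_module.subspace_add ideal_mult_right ideal_gen_base is_ideal_ideal_gen)
      simp_all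
qed

text \<open>Powers of an ideal are spans of products, and this form is what makes induction on the
  exponent possible later. The combinations \<open>u * y + v * z\<close> already form an ideal
  containing every generating product.\<close>

lemma ideal_power_pair:
  assumes "x \<in> ideal_power (ideal_gen {u, v}) (Suc n)"
  obtains y z where "y \<in> ideal_power (ideal_gen {u, v}) n" "z \<in> ideal_power (ideal_gen {u, v}) n"
    "x = u * y + v * z"
proof -
  define J where "J = ideal_power (ideal_gen {u, v}) n"
  have J: "is_ideal J"
    by (simp add: J_def)
  define K where "K = {u * y + v * z | y z. y \<in> J \<and> z \<in> J}"
  have "ideal_gen {a * b | a b. a \<in> ideal_gen {u, v} \<and> b \<in> J} \<subseteq> K"
  proof (rule ideal_gen_minimal)
    show "{a * b | a b. a \<in> ideal_gen {u, v} \<and> b \<in> J} \<subseteq> K"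
    proof
      fix x
      assume "x \<in> {a * b | a b. a \<in> ideal_gen {u, v} \<and> b \<in> J}"
      then obtain y z b where "x = (u * y + v * z) * b" and b: "b \<in> J"
        unfolding ideal_gen_pair by blast
      then have "x = u * (y * b) + v * (z * b)"
        by (simp add: algebra_simps)
      moreover have "y * b \<in> J" "z * b \<in> J"
        using b J by (auto intro: ring_module.subspace_scale)
      ultimately show "x \<in> K"
        unfolding K_def by blast
    qed
    show "is_ideal K"
    proof (rule ring_module.subspaceI)
      have "0 = u * 0 + v * 0" "0 \<in> J"
        using J by (auto intro: ring_module.subspace_0)
      then show "0 \<in> K"
        unfolding K_def by blast
    next
      fix a b
      assume "a \<in> K" "b \<in> K"
      then obtain y z y' z' where *: "a = u * y + v * z" "b = u * y' + v * z'"
        "y \<in> J" "z \<in> J" "y' \<in> J" "z' \<in> J"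
        unfolding K_def by blast
      then have "a + b = u * (y + y') + v * (z + z')"
        by (simp add: algebra_simps)
      moreover have "y + y' \<in> J" "z + z' \<in> J"
        using * J by (auto intro: ring_module.subspace_add)
      ultimately show "a + b \<in> K"
        unfolding K_def by blast
    next
      fix c a
      assume "a \<in> K"
      then obtain y z where *: "a = u * y + v * z" "y \<in> J" "z \<in> J"
        unfolding K_def by blast
      then have "c * a = u * (c * y) + v * (c * z)"
        by (simp add: algebra_simps)
      moreover have "c * y \<in> J" "c * z \<in> J"
        using * J by (auto intro: ring_module.subspace_scale)
      ultimately show "c * a \<in> K"
        unfolding K_def by blast
    qed
  qed
  then show ?thesis
    using assms that unfolding K_def J_def by auto
qed

lemma mult_diff_one_mem:
  assumes "is_ideal J" "x - 1 \<in> J" "y - 1 \<in> J"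
  shows "x * y - 1 \<in> J"
proof -
  have "x * (y - 1) + (x - 1) \<in> J"
    using assms by (intro ring_module.subspace_add ring_module.subspace_scale)
  then show ?thesis
    by (simp add: algebra_simps)
qed

lemma power_diff_one_mem:
  assumes "is_ideal J" "x - 1 \<in> J"
  shows "x ^ n - 1 \<in> J"
  by (induction n) (use assms in \<open>auto intro: mult_diff_one_mem ring_module.subspace_0\<close>)

lemma q_int_diff_of_nat_mem:
  assumes "is_ideal J" "x - 1 \<in> J"
  shows "q_int x n - of_nat n \<in> J"
proof -
  have "q_int x n - of_nat n = (\<Sum>i<n. x ^ i - 1)"
    by (simp add: q_int_def sum_subtractf)
  then show ?thesis
    using assms by (auto intro: ring_module.subspace_sum power_diff_one_mem)
qed

section \<open>Ring homomorphisms and \<open>q\<close>-integers\<close>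

locale ring_homo =
  fixes f :: "'a::comm_ring_1 \<Rightarrow> 'b::comm_ring_1"
  assumes is_hom: "is_ring_hom f"
begin

lemma one [simp]: "f 1 = 1"
  and add [simp]: "f (x + y) = f x + f y"
  and mult [simp]: "f (x * y) = f x * f y"
  using is_hom by (auto simp: is_ring_hom_def)

lemma zero [simp]: "f 0 = 0"
  using add[of 0 0] by simp

lemma minus [simp]: "f (- x) = - f x"
  using add[of x "- x"] by (simp add: eq_neg_iff_add_eq_0 add.commute)

lemma diff [simp]: "f (x - y) = f x - f y"
  using add[of x "- y"] by simp

lemma sum: "f (sum g A) = (\<Sum>x\<in>A. f (g x))"
  by (induction A rule: infinite_finite_induct) simp_all

lemma prod: "f (prod g A) = (\<Prod>x\<in>A. f (g x))"
  by (induction A rule: infinite_finite_induct) simp_all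

lemma power [simp]: "f (x ^ n) = f x ^ n"
  by (induction n) simp_all

lemma of_nat [simp]: "f (of_nat n) = of_nat n"
  by (induction n) simp_all

lemma q_int [simp]: "f (q_int x n) = q_int (f x) n"
  by (simp add: q_int_def sum)

lemma dvd_hom: "a dvd b \<Longrightarrow> f a dvd f b"
  by (auto elim!: dvdE)

lemma ideal_power_mem:
  assumes S: "\<And>x. x \<in> S \<Longrightarrow> f x \<in> ideal_gen T" and "x \<in> ideal_power (ideal_gen S) n"
  shows "f x \<in> ideal_power (ideal_gen T) n"
  using assms(2)
proof (induction n arbitrary: x)
  case (Suc n)
  have vimage: "is_ideal (f -` J)" if "is_ideal J" for J
    by (rule ring_module.subspaceI)
      (use that in \<open>auto intro: ring_module.subspace_0 ring_module.subspace_add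
         ring_module.subspace_scale\<close>)
  have gen: "ideal_gen S \<subseteq> f -` ideal_gen T"
    by (rule ideal_gen_minimal) (use S vimage in auto)
  have "ideal_power (ideal_gen S) (Suc n) \<subseteq> f -` ideal_power (ideal_gen T) (Suc n)"
    unfolding ideal_power.simps(2)[of "ideal_gen S"]
  proof (rule ideal_gen_minimal)
    show "{a * b | a b. a \<in> ideal_gen S \<and> b \<in> ideal_power (ideal_gen S) n}
      \<subseteq> f -` ideal_power (ideal_gen T) (Suc n)"
      using Suc.IH gen by (auto intro!: ideal_gen_base simp del: is_ideal_ideal_gen) blast
  qed (rule vimage, simp)
  then show ?case
    using Suc.prems by blast
qed simp

end

lemma is_ring_hom_comp: "is_ring_hom f \<Longrightarrow> is_ring_hom g \<Longrightarrow> is_ring_hom (\<lambda>x. g (f x))"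
  by (simp add: is_ring_hom_def)

lemma q_int_Suc: "q_int t (Suc n) = q_int t n + t ^ n"
  by (simp add: q_int_def)

lemma q_int_0 [simp]: "q_int t 0 = 0"
  and q_int_1 [simp]: "q_int t (Suc 0) = 1"
  by (simp_all add: q_int_def)

lemma power_diff_one_eq_q_int: "t ^ n - 1 = (t - 1) * q_int t n"
  by (simp add: q_int_def power_diff_1_eq)

lemma q_int_mult: "q_int t (m * n) = q_int t m * q_int (t ^ m) n"
proof (induction n)
  case (Suc n)
  have "q_int t (k + l) = q_int t k + t ^ k * q_int t l" for k l
    by (induction l) (simp_all add: q_int_Suc power_add algebra_simps)
  then have "q_int t (m * Suc n) = q_int t (m * n) + t ^ (m * n) * q_int t m"
    by (metis add.commute mult_Suc_right)
  with Suc show ?case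
    by (simp add: q_int_Suc power_mult algebra_simps)
qed simp

section \<open>The completion, handled through representatives modulo powers of the ideal\<close>

locale completion =
  fixes I :: "'a::comm_ring_1 set" and \<iota> :: "'a \<Rightarrow> 'h::comm_ring_1" and pr :: "nat \<Rightarrow> 'h \<Rightarrow> 'a set"
  assumes completion: "adic_completion I \<iota> pr"
    and ideal_I: "is_ideal I"
begin

abbreviation P :: "nat \<Rightarrow> 'a set" where "P \<equiv> ideal_power I"

text \<open>Computing with representatives avoids products of cosets as sets, which may be smaller
  than the coset of the product.\<close>

definition approx :: "'h \<Rightarrow> nat \<Rightarrow> 'a \<Rightarrow> bool" where
  "approx h n a \<longleftrightarrow> pr n h = a +o P n"

lemma coset_eq_iff: "a +o P n = b +o P n \<longleftrightarrow> a - b \<in> P n"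
proof
  assume "a +o P n = b +o P n"
  moreover have "a \<in> a +o P n"
    using ring_module.subspace_0[OF is_ideal_ideal_power] by (force simp: elt_set_plus_def)
  ultimately obtain y where "y \<in> P n" "a = b + y"
    by (auto simp: elt_set_plus_def)
  then show "a - b \<in> P n"
    by simp
next
  have *: "c +o P n \<subseteq> d +o P n" if "c - d \<in> P n" for c d
  proof
    fix x
    assume "x \<in> c +o P n"
    then obtain y where y: "y \<in> P n" "x = c + y"
      by (auto simp: elt_set_plus_def)
    then have "x = d + ((c - d) + y)" "(c - d) + y \<in> P n"
      using that by (auto intro: ring_module.subspace_add)
    then show "x \<in> d +o P n"
      unfolding elt_set_plus_def by blast
  qed
  assume "a - b \<in> P n"
  moreover from this have "b - a \<in> P n"
    using ring_module.subspace_neg[of "P n" "a - b"] by simp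
  ultimately show "a +o P n = b +o P n"
    using * by blast
qed

lemma mem_coset_iff: "x \<in> a +o P n \<longleftrightarrow> x - a \<in> P n"
  by (auto simp: elt_set_plus_def intro: bexI[of _ "x - a"])

lemma approx_unique: "approx h n a \<Longrightarrow> approx h n b \<Longrightarrow> a - b \<in> P n"
  by (simp add: approx_def coset_eq_iff)

lemma approx_cong: "approx h n a \<Longrightarrow> a - b \<in> P n \<Longrightarrow> approx h n b"
  using coset_eq_iff[of a n b] by (simp add: approx_def)

lemma approx_iota: "approx (\<iota> a) n a"
  using completion by (simp add: approx_def adic_completion_def)

lemma pr_limit: "(\<lambda>n. pr n h) \<in> adic_limit I"
  using completion unfolding adic_completion_def bij_betw_def by blast

lemma approx_exists: obtains a where "approx h n a"
  using pr_limit[of h] unfolding adic_limit_def approx_def by blast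

lemma approx_Suc: "approx h (Suc n) a \<Longrightarrow> approx h n a"
proof -
  assume a: "approx h (Suc n) a"
  obtain b where b: "approx h n b"
    by (rule approx_exists)
  have "pr (Suc n) h \<subseteq> pr n h"
    using pr_limit[of h] by (simp add: adic_limit_def)
  moreover have "a \<in> a +o P (Suc n)"
    using ring_module.subspace_0[OF is_ideal_ideal_power]
    by (simp only: mem_coset_iff diff_self)
  ultimately have "a \<in> b +o P n"
    using a b by (auto simp: approx_def)
  then have "a - b \<in> P n"
    by (simp only: mem_coset_iff)
  then have "b - a \<in> P n"
    using ring_module.subspace_neg[of "P n" "a - b"] by simp
  then show ?thesis
    using approx_cong b by blast
qed

lemma approx_antimono: "approx h m a \<Longrightarrow> n \<le> m \<Longrightarrow> approx h n a"
  by (rule dec_induct[of n m "\<lambda>k. approx h k a \<longrightarrow> approx h n a", THEN mp])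
    (auto dest: approx_Suc)

lemma approx_eqI:
  assumes "\<And>n. \<exists>a. approx h n a \<and> approx h' n a"
  shows "h = h'"
proof -
  have "(\<lambda>n. pr n h) = (\<lambda>n. pr n h')"
    using assms unfolding approx_def by metis
  then show ?thesis
    using completion unfolding adic_completion_def bij_betw_def inj_on_def by blast
qed

lemma approx_add: "approx h n a \<Longrightarrow> approx h' n a' \<Longrightarrow> approx (h + h') n (a + a')"
proof -
  assume a: "approx h n a" "approx h' n a'"
  obtain b where b: "approx (h + h') n b"
    by (rule approx_exists)
  have "pr n (h + h') = pr n h + pr n h'"
    using completion by (simp add: adic_completion_def)
  moreover have "a \<in> a +o P n" "a' \<in> a' +o P n"
    using ring_module.subspace_0[OF is_ideal_ideal_power] by (simp_all only: mem_coset_iff) simp_all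
  ultimately have "a + a' \<in> b +o P n"
    using a b by (auto simp: approx_def)
  then have "a + a' - b \<in> P n"
    by (simp only: mem_coset_iff)
  then have "b - (a + a') \<in> P n"
    using ring_module.subspace_neg[of "P n" "a + a' - b"] by simp
  then show ?thesis
    using approx_cong b by blast
qed

text \<open>The set product of the two cosets is only contained in the coset of
  \<open>h * h'\<close>, but it contains \<open>a * a'\<close>, and one common element determines a
  coset.\<close>

lemma approx_mult: "approx h n a \<Longrightarrow> approx h' n a' \<Longrightarrow> approx (h * h') n (a * a')"
proof -
  assume a: "approx h n a" "approx h' n a'"
  obtain b where b: "approx (h * h') n b"
    by (rule approx_exists)
  have "pr n h * pr n h' \<subseteq> pr n (h * h')"
    using completion by (simp add: adic_completion_def)
  moreover have "a \<in> a +o P n" "a' \<in> a' +o P n"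
    using ring_module.subspace_0[OF is_ideal_ideal_power] by (simp_all only: mem_coset_iff) simp_all
  ultimately have "a * a' \<in> b +o P n"
    using a b by (auto simp: approx_def)
  then have "a * a' - b \<in> P n"
    by (simp only: mem_coset_iff)
  then have "b - a * a' \<in> P n"
    using ring_module.subspace_neg[of "P n" "a * a' - b"] by simp
  then show ?thesis
    using approx_cong b by blast
qed

lemma is_ring_hom_iota: "is_ring_hom \<iota>"
proof -
  have "approx 1 n 1" for n
    using completion by (simp add: approx_def adic_completion_def)
  then show ?thesis
    unfolding is_ring_hom_def
    by (intro conjI allI approx_eqI) (blast intro: approx_iota approx_add approx_mult)+
qed

sublocale iota: ring_homo \<iota>
  by unfold_locales (rule is_ring_hom_iota)

lemma approx_0: "approx 0 n 0"
  using approx_iota[of 0 n] by simp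

lemma approx_minus: "approx h n a \<Longrightarrow> approx (- h) n (- a)"
  using approx_mult[OF approx_iota[of "- 1" n], of h a] by simp

lemma approx_diff: "approx h n a \<Longrightarrow> approx h' n a' \<Longrightarrow> approx (h - h') n (a - a')"
  using approx_add[of h n a "- h'" "- a'"] approx_minus by simp

abbreviation N :: "nat \<Rightarrow> 'h set" where "N \<equiv> limit_nbhd pr"

lemma N_iff: "h \<in> N n \<longleftrightarrow> approx h n 0"
  using approx_0[of n] by (auto simp: limit_nbhd_def approx_def)

lemma approx_mem_N: "approx h n a \<Longrightarrow> h \<in> N n \<longleftrightarrow> a \<in> P n"
  using approx_unique[of h n a 0] approx_cong[of h n a 0] by (auto simp: N_iff)

lemma mem_N_0: "h \<in> N 0"
proof -
  obtain a where "approx h 0 a"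
    by (rule approx_exists)
  from approx_mem_N[OF this] show ?thesis
    by simp
qed

lemma is_ideal_N [simp]: "is_ideal (N n)"
proof (rule ring_module.subspaceI)
  show "0 \<in> N n"
    by (simp add: N_iff approx_0)
  show "x + y \<in> N n" if "x \<in> N n" "y \<in> N n" for x y
    using that approx_add[of x n 0 y 0] by (simp add: N_iff)
  show "c * x \<in> N n" if "x \<in> N n" for c x
  proof -
    obtain a where "approx c n a"
      by (rule approx_exists)
    from approx_mult[OF this, of x 0] that show ?thesis
      by (simp add: N_iff)
  qed
qed

lemma N_antimono: "m \<le> n \<Longrightarrow> N n \<subseteq> N m"
  by (auto simp: N_iff intro: approx_antimono)

lemma approx_iff: "approx h n a \<longleftrightarrow> h - \<iota> a \<in> N n"
proof
  assume "approx h n a"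
  then show "h - \<iota> a \<in> N n"
    using approx_diff[OF _ approx_iota, of h n a a] by (simp add: N_iff)
next
  assume "h - \<iota> a \<in> N n"
  then show "approx h n a"
    using approx_add[OF _ approx_iota, of "h - \<iota> a" n 0 a] by (simp add: N_iff)
qed

lemma N_separated: "(\<And>n. h \<in> N n) \<Longrightarrow> h = 0"
  by (rule approx_eqI) (auto simp: N_iff intro: approx_0)

lemma iota_mult_N_Suc: "a \<in> I \<Longrightarrow> h \<in> N n \<Longrightarrow> \<iota> a * h \<in> N (Suc n)"
proof -
  assume a: "a \<in> I" and h: "h \<in> N n"
  \<comment> \<open>The representative is taken one level finer than \<open>h \<in> N n\<close>
    suggests: it lies in \<open>P n\<close>, and its product with \<open>a\<close> then decides
    membership at level \<open>Suc n\<close>.\<close>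
  obtain b where b: "approx h (Suc n) b"
    by (rule approx_exists)
  then have "b \<in> P n"
    using approx_Suc approx_mem_N h by blast
  then have "a * b \<in> P (Suc n)"
    using a by (rule ideal_power_Suc_mem[rotated])
  then show ?thesis
    using approx_mem_N[OF approx_mult[OF approx_iota b]] by blast
qed

lemma complete:
  assumes "\<And>n. a (Suc n) - a n \<in> P n"
  obtains h where "\<And>n. approx h n (a n)"
proof -
  have "(\<lambda>n. a n +o P n) \<in> adic_limit I"
    unfolding adic_limit_def
  proof (intro CollectI conjI allI)
    fix n
    show "\<exists>b. a n +o P n = b +o P n"
      by blast
    show "a (Suc n) +o P (Suc n) \<subseteq> a n +o P n"
    proof
      fix x
      assume "x \<in> a (Suc n) +o P (Suc n)"
      then have "x - a (Suc n) \<in> P n"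
        using ideal_power_Suc_subset unfolding mem_coset_iff by blast
      then have "(x - a (Suc n)) + (a (Suc n) - a n) \<in> P n"
        using assms by (intro ring_module.subspace_add) auto
      then show "x \<in> a n +o P n"
        by (simp add: mem_coset_iff)
    qed
  qed
  then obtain h where "(\<lambda>n. pr n h) = (\<lambda>n. a n +o P n)"
    using completion unfolding adic_completion_def bij_betw_def by (metis imageE)
  then have "approx h n (a n)" for n
    by (simp add: approx_def fun_eq_iff)
  then show ?thesis
    using that by blast
qed

text \<open>The inverse is the geometric series.\<close>
lemma iota_unit:
  assumes "x - 1 \<in> I"
  shows "\<iota> x dvd 1"
proof -
  define y where "y = 1 - x"
  have "y \<in> I"
    using ring_module.subspace_neg[OF ideal_I assms] by (simp add: y_def)
  then have y: "y ^ n \<in> P n" for n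
    using power_mult_mem_ideal_power[of y I n 1] by simp
  then obtain h where h: "\<And>n. approx h n (\<Sum>k<n. y ^ k)"
    using complete[of "\<lambda>n. \<Sum>k<n. y ^ k"] by auto
  have "\<iota> x * h = 1"
  proof (rule approx_eqI)
    fix n
    have "x * (\<Sum>k<n. y ^ k) = 1 - y ^ n"
      by (simp add: one_diff_power_eq y_def)
    then have "x * (\<Sum>k<n. y ^ k) - 1 \<in> P n"
      using ring_module.subspace_neg[OF is_ideal_ideal_power y] by simp
    then have "approx (\<iota> x * h) n 1"
      using approx_cong[OF approx_mult[OF approx_iota h]] by blast
    then show "\<exists>a. approx (\<iota> x * h) n a \<and> approx 1 n a"
      using approx_iota[of 1 n] by auto
  qed
  then show ?thesis
    by (metis dvdI)
qed

text \<open>The images of successive approximations of \<open>h\<close> are coherent, and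
  completeness glues them. Describing \<open>\<tau>\<close> by all approximations at once is what
  later transfers additivity, multiplicativity and continuity to it.\<close>

lemma extend_by_continuity:
  fixes g :: "'a \<Rightarrow> 'h"
  assumes add: "\<And>x y. g (x + y) = g x + g y"
    and g: "\<And>n x. x \<in> P n \<Longrightarrow> g x \<in> N n"
  obtains \<tau> where "\<And>h n a. approx h n a \<Longrightarrow> \<tau> h - g a \<in> N n"
proof -
  have diff: "g (x - y) = g x - g y" for x y
    using add[of "x - y" y] by simp
  have "\<exists>y. \<forall>n a. approx h n a \<longrightarrow> y - g a \<in> N n" for h
  proof -
    have "\<forall>n. \<exists>a. approx h n a"
      by (metis approx_exists)
    then obtain a where a: "\<And>n. approx h n (a n)"
      by metis
    have "\<forall>n. \<exists>b. approx (g (a n)) n b"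
      by (metis approx_exists)
    then obtain b where b: "\<And>n. approx (g (a n)) n (b n)"
      by metis
    have "b (Suc n) - b n \<in> P n" for n
    proof -
      have "a (Suc n) - a n \<in> P n"
        using a approx_Suc approx_unique by blast
      then have "g (a (Suc n)) - g (a n) \<in> N n"
        using g by (simp flip: diff)
      moreover have "approx (g (a (Suc n)) - g (a n)) n (b (Suc n) - b n)"
        by (intro approx_diff b approx_Suc[OF b])
      ultimately show ?thesis
        using approx_mem_N by blast
    qed
    then obtain y where y: "\<And>n. approx y n (b n)"
      using complete by blast
    have "y - g c \<in> N n" if "approx h n c" for n c
    proof -
      have "approx (y - g (a n)) n (b n - b n)"
        by (intro approx_diff y b)
      then have "y - g (a n) \<in> N n"
        by (simp add: N_iff)
      moreover have "g (a n) - g c \<in> N n"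
        using approx_unique[OF a that] g by (simp flip: diff)
      ultimately show ?thesis
        using ring_module.subspace_add[OF is_ideal_N, of "y - g (a n)" n "g (a n) - g c"] by simp
    qed
    then show ?thesis
      by blast
  qed
  then show ?thesis
    using that by metis
qed

lemma eq_of_eq_on_iota:
  assumes cont: "filt_continuous N N f" "filt_continuous N N g" and eq: "\<And>a. f (\<iota> a) = g (\<iota> a)"
  shows "f = g"
proof
  fix h
  have "f h - g h \<in> N n" for n
  proof -
    obtain m1 m2 where m1: "\<And>y. y - h \<in> N m1 \<Longrightarrow> f y - f h \<in> N n"
      and m2: "\<And>y. y - h \<in> N m2 \<Longrightarrow> g y - g h \<in> N n"
      using cont unfolding filt_continuous_def by metis
    obtain a where a: "approx h (max m1 m2) a"
      by (rule approx_exists)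
    have *: "\<iota> a - h \<in> N m" if "m \<le> max m1 m2" for m
      using a that ring_module.subspace_neg[OF is_ideal_N, of "h - \<iota> a" m]
      by (auto simp: approx_iff dest: N_antimono)
    have "(g (\<iota> a) - g h) - (f (\<iota> a) - f h) \<in> N n"
      using * by (intro ring_module.subspace_diff[OF is_ideal_N, of "g (\<iota> a) - g h"] m1 m2) simp_all
    then show ?thesis
      by (simp add: eq)
  qed
  then show "f h = g h"
    using N_separated[of "f h - g h"] by simp
qed

end

section \<open>\<open>q\<close>-integers and interpolation\<close>

text \<open>Integrality of Gaussian binomials without division: for \<open>m \<ge> i\<close> the
  quotient is a power of \<open>t\<close> times the binomial of \<open>m\<close> over
  \<open>i\<close> at \<open>t\<close>, and for \<open>m < i\<close> the right side is 0.\<close>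

lemma prod_power_diff_dvd:
  fixes t :: "'a::comm_ring_1"
  shows "(\<Prod>j<i. t ^ Suc j - 1) dvd (\<Prod>k<i. t ^ m - t ^ k)"
proof (induction m arbitrary: i)
  case 0
  show ?case
  proof (cases i)
    case (Suc i')
    then have "(\<Prod>k<i. t ^ 0 - t ^ k) = 0"
      by (simp add: prod.lessThan_Suc_shift del: prod.lessThan_Suc)
    then show ?thesis
      by (metis dvd_0_right)
  qed simp
next
  case (Suc m)
  show ?case
  proof (cases i)
    case (Suc i')
    have shift: "(\<Prod>k<Suc i'. t ^ Suc m - t ^ k) = t ^ i' * (t ^ Suc m - 1) * (\<Prod>k<i'. t ^ m - t ^ k)"
    proof -
      have "(\<Prod>k<Suc i'. t ^ Suc m - t ^ k) = (t ^ Suc m - 1) * (\<Prod>k<i'. t * (t ^ m - t ^ k))"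
        by (simp add: prod.lessThan_Suc_shift algebra_simps del: prod.lessThan_Suc)
      also have "(\<Prod>k<i'. t * (t ^ m - t ^ k)) = t ^ i' * (\<Prod>k<i'. t ^ m - t ^ k)"
        by (simp add: prod.distrib)
      finally show ?thesis
        by (simp add: mult_ac)
    qed
    \<comment> \<open>Pascal's rule in the form
      \<open>t ^ Suc m - 1 = t * (t ^ m - t ^ i') + (t ^ Suc i' - 1)\<close>.\<close>
    also have "\<dots> = t ^ Suc i' * (\<Prod>k<Suc i'. t ^ m - t ^ k)
        + t ^ i' * ((t ^ Suc i' - 1) * (\<Prod>k<i'. t ^ m - t ^ k))"
      by (simp add: algebra_simps)
    also have "(\<Prod>j<Suc i'. t ^ Suc j - 1) dvd \<dots>"
      using dvd_mult[OF mult_dvd_mono[OF dvd_refl Suc.IH[of i'], of "t ^ Suc i' - 1"], of "t ^ i'"]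
      by (intro dvd_add dvd_mult[OF Suc.IH]) (simp add: mult.commute)
    finally show ?thesis
      by (simp only: Suc)
  qed simp
qed

text \<open>On the diagonal the preceding divisibility is sharp up to a power of \<open>t\<close>,
  because \<open>t ^ k - t ^ i\<close> is \<open>t ^ i\<close> times
  \<open>t ^ (k - i) - 1\<close>.\<close>

lemma prod_power_diff_self:
  fixes t :: "'a::comm_ring_1"
  shows "\<exists>N. (\<Prod>i<k. t ^ k - t ^ i) = t ^ N * (\<Prod>j<k. t ^ Suc j - 1)"
proof -
  have "(\<Prod>i<k. t ^ k - t ^ i) = (\<Prod>i<k. t ^ i * (t ^ Suc (k - Suc i) - 1))"
  proof (rule prod.cong)
    fix i
    assume "i \<in> {..<k}"
    then have "t ^ k = t ^ i * t ^ Suc (k - Suc i)"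
      by (simp flip: power_Suc power_add)
    then show "t ^ k - t ^ i = t ^ i * (t ^ Suc (k - Suc i) - 1)"
      by (simp add: right_diff_distrib)
  qed simp
  also have "\<dots> = t ^ (\<Sum>i<k. i) * (\<Prod>j<k. t ^ Suc j - 1)"
    by (simp only: prod.distrib power_sum prod.nat_diff_reindex[of "\<lambda>j. t ^ Suc j - 1"])
  finally show ?thesis
    by blast
qed

text \<open>\<open>cyclo p t l\<close> is the value at \<open>t\<close> of the \<open>p\<^bsup>l+1\<^esup>\<close>-th cyclotomic polynomial. For
  \<open>0 < e \<le> L\<close> and \<open>v\<close> the \<open>p\<close>-adic valuation of \<open>e\<close>, \<open>p_part p t L e\<close> is \<open>(p\<^bsup>v+1\<^esup>)\<^sub>t\<close>.\<close>
definition cyclo :: "nat \<Rightarrow> 'a::comm_ring_1 \<Rightarrow> nat \<Rightarrow> 'a" where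
  "cyclo p t l = q_int (t ^ (p ^ l)) p"

definition p_part :: "nat \<Rightarrow> 'a::comm_ring_1 \<Rightarrow> nat \<Rightarrow> nat \<Rightarrow> 'a" where
  "p_part p t L e = (\<Prod>l | l < L \<and> p ^ l dvd e. cyclo p t l)"

lemma q_int_prime_power: "q_int t (p ^ i) = (\<Prod>l<i. cyclo p t l)"
proof (induction i)
  case (Suc i)
  have "q_int t (p ^ Suc i) = q_int t (p ^ i) * cyclo p t i"
    using q_int_mult[of t "p ^ i" p] by (simp add: cyclo_def mult.commute)
  with Suc show ?case
    by simp
qed simp

text \<open>An initial segment is what turns \<open>p_part\<close> into a \<open>q\<close>-integer
  of a power of \<open>p\<close>. The bound \<open>L\<close> also covers \<open>e = 0\<close>, which
  every power of \<open>p\<close> divides.\<close>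

lemma prime_power_divisors_initial:
  fixes p :: nat
  obtains i where "i \<le> L" "{l. l < L \<and> p ^ l dvd e} = {..<i}"
proof -
  have "\<exists>i\<le>L. {l. l < L \<and> p ^ l dvd e} = {..<i}"
  proof (induction L)
    case (Suc L)
    show ?case
    proof (cases "p ^ L dvd e")
      case True
      then have "p ^ l dvd e" if "l \<le> L" for l
        using that by (meson dvd_trans le_imp_power_dvd)
      then have "{l. l < Suc L \<and> p ^ l dvd e} = {..<Suc L}"
        by auto
      then show ?thesis
        by blast
    next
      case False
      then have "{l. l < Suc L \<and> p ^ l dvd e} = {l. l < L \<and> p ^ l dvd e}"
        by (auto simp: less_Suc_eq)
      with Suc show ?thesis
        by (metis le_SucI)
    qed
  qed simp
  then show ?thesis
    using that by blast
qed

lemma p_part_dvd: "(t - 1) * p_part p t L e dvd t ^ (p * e) - 1"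
proof -
  obtain i where i: "i \<le> L" "{l. l < L \<and> p ^ l dvd e} = {..<i}"
    by (rule prime_power_divisors_initial)
  \<comment> \<open>\<open>i\<close> counts the exponents \<open>0, ..., i - 1\<close>, so only
    \<open>p ^ (i - 1)\<close> is known to divide \<open>e\<close>; the extra factor
    \<open>p\<close> makes up for it.\<close>
  have "p ^ i dvd p * e"
  proof (cases i)
    case (Suc i')
    then have "p ^ i' dvd e"
      using i by blast
    then show ?thesis
      using Suc by simp
  qed simp
  then obtain c where c: "p * e = p ^ i * c"
    by blast
  have "(t - 1) * p_part p t L e = t ^ (p ^ i) - 1"
    by (simp add: p_part_def i(2) power_diff_one_eq_q_int q_int_prime_power)
  moreover have "(t ^ p ^ i - 1) dvd (t ^ p ^ i) ^ c - 1"
    by (simp add: power_diff_one_eq_q_int[of "t ^ p ^ i"])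
  ultimately show ?thesis
    by (simp add: c power_mult)
qed

text \<open>As \<open>M\<close> is invertible modulo \<open>d\<close>, exactly one of any
  \<open>d\<close> consecutive \<open>k\<close> is a solution, whereas the multiples of
  \<open>d\<close> among \<open>1, ..., n\<close> come last in their blocks of length
  \<open>d\<close>.\<close>

lemma card_multiples_le_card_progression:
  fixes M d m :: nat
  assumes "coprime M d"
  shows "card {j. j < n \<and> d dvd Suc j} \<le> card {k. k < n \<and> d dvd m + M * k}"
proof (cases "d = 0")
  case False
  obtain x where x: "[M * x = 1] (mod d)"
    using cong_solve_coprime_nat[OF assms] by auto
  \<comment> \<open>The residue of \<open>- m / M\<close> modulo \<open>d\<close>, with
    \<open>m * (d - 1)\<close> standing for \<open>- m\<close> in the natural numbers.\<close>
  define k0 where "k0 = (x * (m * (d - 1))) mod d"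
  have "[m + M * k0 = m + M * (x * (m * (d - 1)))] (mod d)"
    by (intro cong_add cong_mult cong_refl) (simp add: k0_def cong_def)
  then have "[m + M * k0 = m + M * x * (m * (d - 1))] (mod d)"
    by (simp only: mult.assoc)
  also have "[m + M * x * (m * (d - 1)) = m + 1 * (m * (d - 1))] (mod d)"
    by (intro cong_add cong_mult cong_refl x)
  also have "m + 1 * (m * (d - 1)) = m * d"
    using False by (cases d) simp_all
  also have "[m * d = 0] (mod d)"
    by (simp add: cong_def)
  finally have k0: "d dvd m + M * k0"
    by (simp add: cong_0_iff)
  have "k0 < d"
    using False by (simp add: k0_def)
  show ?thesis
  \<comment> \<open>A multiple \<open>Suc j\<close> of \<open>d\<close> is sent to the solution
    among \<open>Suc j - d, ..., j\<close>; it stays below \<open>n\<close> because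
    \<open>k0 < d\<close>.\<close>
  proof (rule card_inj_on_le[of "\<lambda>j. Suc j - d + k0"])
    show "inj_on (\<lambda>j. Suc j - d + k0) {j. j < n \<and> d dvd Suc j}"
    proof (rule inj_onI)
      fix i j
      assume *: "i \<in> {j. j < n \<and> d dvd Suc j}" "j \<in> {j. j < n \<and> d dvd Suc j}"
        "Suc i - d + k0 = Suc j - d + k0"
      then have "d \<le> Suc i" "d \<le> Suc j"
        by (auto dest: dvd_imp_le)
      with * show "i = j"
        by linarith
    qed
    show "(\<lambda>j. Suc j - d + k0) ` {j. j < n \<and> d dvd Suc j} \<subseteq> {k. k < n \<and> d dvd m + M * k}"
    proof (rule image_subsetI)
      fix j
      assume j: "j \<in> {j. j < n \<and> d dvd Suc j}"
      then have le: "d \<le> Suc j"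
        by (auto dest: dvd_imp_le)
      have "d dvd Suc j - d"
        using j by (auto intro: dvd_diff_nat)
      then have "d dvd M * (Suc j - d) + (m + M * k0)"
        using k0 by (rule dvd_add[OF dvd_mult])
      moreover have "Suc j - d + k0 < n"
        using j le \<open>k0 < d\<close> by (simp only: mem_Collect_eq) linarith
      ultimately show "Suc j - d + k0 \<in> {k. k < n \<and> d dvd m + M * k}"
        by (simp only: mem_Collect_eq distrib_left add_ac)
    qed
  qed simp
qed (use assms in \<open>simp add: dvd_def\<close>)

lemma prod_if_const:
  fixes c :: "'a::comm_monoid_mult"
  shows "(\<Prod>k<n::nat. if Q k then c else 1) = c ^ card {k. k < n \<and> Q k}"
proof -
  have "(\<Prod>k<n. if Q k then c else 1) = (\<Prod>k\<in>{k \<in> {..<n}. Q k}. c)"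
    by (rule prod.inter_filter[symmetric]) simp
  then show ?thesis
    by simp
qed

text \<open>Exchanging the two products reduces divisibility between such products to a comparison
  of exponents, one for each cyclotomic factor.\<close>

lemma prod_p_part:
  "(\<Prod>k<n::nat. p_part p t L (e k)) = (\<Prod>l<L. cyclo p t l ^ card {k. k < n \<and> p ^ l dvd e k})"
proof -
  have "(\<Prod>k<n. p_part p t L (e k)) = (\<Prod>k<n. \<Prod>l<L. if p ^ l dvd e k then cyclo p t l else 1)"
    unfolding p_part_def
    by (rule prod.cong[OF refl]) (simp flip: prod.inter_filter)
  also have "\<dots> = (\<Prod>l<L. \<Prod>k<n. if p ^ l dvd e k then cyclo p t l else 1)"
    by (rule prod.swap)
  also have "\<dots> = (\<Prod>l<L. cyclo p t l ^ card {k. k < n \<and> p ^ l dvd e k})"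
    by (rule prod.cong[OF refl], rule prod_if_const)
  finally show ?thesis .
qed

lemma prod_p_part_dvd_progression:
  fixes t :: "'a::comm_ring_1"
  assumes "coprime M p"
  shows "(t - 1) ^ n * (\<Prod>j<n. p_part p t L (Suc j)) dvd (\<Prod>k<n. t ^ (p * (m + M * k)) - 1)"
proof -
  have "(\<Prod>j<n. p_part p t L (Suc j)) dvd (\<Prod>k<n. p_part p t L (m + M * k))"
    unfolding prod_p_part
  proof (intro prod_dvd_prod le_imp_power_dvd card_multiples_le_card_progression)
    show "coprime M (p ^ l)" for l
      using assms by simp
  qed
  then have "(t - 1) ^ n * (\<Prod>j<n. p_part p t L (Suc j))
      dvd (t - 1) ^ n * (\<Prod>k<n. p_part p t L (m + M * k))"
    by (intro mult_dvd_mono dvd_refl)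
  also have "(t - 1) ^ n * (\<Prod>k<n. p_part p t L (m + M * k)) =
      (\<Prod>k<n. (t - 1) * p_part p t L (m + M * k))"
    by (simp add: prod.distrib)
  also have "\<dots> dvd (\<Prod>k<n. t ^ (p * (m + M * k)) - 1)"
    by (intro prod_dvd_prod p_part_dvd)
  finally show ?thesis .
qed

text \<open>Write \<open>j = p ^ v * c\<close> with \<open>c\<close> prime to \<open>p\<close>. The
  cofactor is a \<open>q\<close>-integer of \<open>c\<close>, which will become a unit in the
  completion.\<close>

lemma q_int_eq_p_part:
  assumes "prime p" "j > 0" "j \<le> L"
  obtains i c where "\<not> p dvd c" "q_int t (p * j) = p_part p t L j * q_int (t ^ p ^ i) c"
proof -
  define v where "v = multiplicity p j"
  have p: "\<not> is_unit p" "j \<noteq> 0"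
    using assms by auto
  obtain c where c: "j = p ^ v * c" "\<not> p dvd c"
    using multiplicity_decompose'[OF p(2,1)] unfolding v_def by blast
  have "{l. l < L \<and> p ^ l dvd j} = {..<Suc v}"
  proof -
    \<comment> \<open>The bound \<open>j \<le> L\<close> ensures that the truncation drops no
      factor: \<open>l < p ^ l \<le> j \<le> L\<close>.\<close>
    have "l < L" if "p ^ l dvd j" for l
    proof -
      have "l < p ^ l"
        using assms(1) by (simp add: power_gt_expt prime_gt_Suc_0_nat)
      also have "\<dots> \<le> j"
        using that assms(2) by (rule dvd_imp_le)
      finally show ?thesis
        using assms(3) by simp
    qed
    then show ?thesis
      using p by (auto simp: v_def power_dvd_iff_le_multiplicity less_Suc_eq_le)
  qed
  then have "p_part p t L j = q_int t (p ^ Suc v)"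
    by (simp only: p_part_def q_int_prime_power)
  then have "q_int t (p * j) = p_part p t L j * q_int (t ^ p ^ Suc v) c"
    using q_int_mult[of t "p ^ Suc v" c] by (simp add: c(1) mult.assoc)
  then show ?thesis
    using that c(2) by blast
qed

section \<open>Congruences modulo \<open>p\<close> for cyclotomic values\<close>

lemma of_nat_dvd_mono: "m dvd n \<Longrightarrow> of_nat m dvd (of_nat n :: 'a::comm_semiring_1)"
  by (metis dvd_def of_nat_mult)

lemma prime_dvd_freshman:
  fixes x y :: "'a::comm_ring_1"
  assumes "prime p"
  shows "of_nat p dvd (x + y) ^ p - (x ^ p + y ^ p)"
proof -
  have "{..p} = insert 0 (insert p {1..<p})"
    using prime_gt_0_nat[OF assms] by auto
  then have "(x + y) ^ p = x ^ p + y ^ p + (\<Sum>k\<in>{1..<p}. of_nat (p choose k) * x ^ k * y ^ (p - k))"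
    using prime_gt_0_nat[OF assms] by (simp add: binomial_ring)
  moreover have "of_nat p dvd (\<Sum>k\<in>{1..<p}. of_nat (p choose k) * x ^ k * y ^ (p - k))"
  proof (rule dvd_sum)
    fix k
    assume "k \<in> {1..<p}"
    then have "p dvd p choose k"
      using assms by (intro dvd_choose_prime) auto
    then show "of_nat p dvd of_nat (p choose k) * x ^ k * y ^ (p - k)"
      by (intro dvd_mult2 of_nat_dvd_mono)
  qed
  ultimately show ?thesis
    by simp
qed

lemma dvd_power_diff_power:
  fixes x y :: "'a::comm_ring_1"
  assumes "d dvd x - y"
  shows "d dvd x ^ n - y ^ n"
  using dvd_trans[OF assms, of "x ^ n - y ^ n"] by (simp add: power_diff_sumr2)

lemma prime_dvd_one_plus_power:
  fixes x :: "'a::comm_ring_1"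
  assumes "prime p"
  shows "of_nat p dvd (1 + x) ^ (p ^ l) - (1 + x ^ (p ^ l))"
proof (induction l)
  case (Suc l)
  let ?y = "x ^ (p ^ l)"
  have "of_nat p dvd ((1 + x) ^ (p ^ l)) ^ p - (1 + ?y) ^ p"
    by (rule dvd_power_diff_power) (rule Suc)
  moreover have "of_nat p dvd (1 + ?y) ^ p - (1 ^ p + ?y ^ p)"
    by (rule prime_dvd_freshman[OF assms])
  ultimately have "of_nat p dvd ((1 + x) ^ (p ^ l)) ^ p - (1 + ?y) ^ p + ((1 + ?y) ^ p - (1 ^ p + ?y ^ p))"
    by (rule dvd_add)
  then show ?case
    by (simp add: algebra_simps flip: power_mult)
qed simp

lemma q_int_one_plus: "q_int (1 + y) n = (\<Sum>i<n. of_nat (n choose Suc i) * y ^ i)"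
proof (induction n)
  case (Suc n)
  have "(1 + y) ^ n = (\<Sum>i<Suc n. of_nat (n choose i) * y ^ i)"
    using binomial_ring[of y 1 n] by (simp add: add.commute lessThan_Suc_atMost)
  moreover have "of_nat (n choose Suc n) = (0::'a)"
    by (simp add: binomial_eq_0)
  ultimately show ?case
    using Suc by (simp add: q_int_Suc sum.distrib algebra_simps)
qed simp

text \<open>With \<open>y = (1 + x) ^ (p ^ l) - 1\<close>, the value is the polynomial
  \<open>((1 + y) ^ p - 1) / y\<close>, which is \<open>y ^ (p - 1)\<close> modulo \<open>p\<close>,
  and \<open>y\<close> is \<open>x ^ (p ^ l)\<close> modulo \<open>p\<close>. This will make
  cyclotomic values regular in the completion.\<close>

lemma prime_dvd_cyclo:
  fixes x :: "'a::comm_ring_1"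
  assumes "prime p"
  shows "of_nat p dvd cyclo p (1 + x) l - x ^ (p ^ l * (p - 1))"
proof -
  define y where "y = (1 + x) ^ (p ^ l) - 1"
  have p: "p = Suc (p - 1)"
    using prime_gt_0_nat[OF assms] by simp
  have "cyclo p (1 + x) l = (\<Sum>i<p. of_nat (p choose Suc i) * y ^ i)"
    using q_int_one_plus[of y p] by (simp add: cyclo_def y_def)
  also have "\<dots> = y ^ (p - 1) + (\<Sum>i<p - 1. of_nat (p choose Suc i) * y ^ i)"
    by (subst p, subst sum.lessThan_Suc) (use p in simp)
  finally have "cyclo p (1 + x) l - y ^ (p - 1) = (\<Sum>i<p - 1. of_nat (p choose Suc i) * y ^ i)"
    by simp
  also have "of_nat p dvd \<dots>"
  proof (rule dvd_sum)
    fix i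
    assume "i \<in> {..<p - 1}"
    then have "p dvd p choose Suc i"
      using assms by (intro dvd_choose_prime) auto
    then show "of_nat p dvd of_nat (p choose Suc i) * y ^ i"
      by (intro dvd_mult2 of_nat_dvd_mono)
  qed
  finally have "of_nat p dvd cyclo p (1 + x) l - y ^ (p - 1)" .
  moreover have "of_nat p dvd y ^ (p - 1) - (x ^ (p ^ l)) ^ (p - 1)"
    using prime_dvd_one_plus_power[OF assms, of x l]
    by (intro dvd_power_diff_power) (simp add: y_def algebra_simps)
  ultimately have "of_nat p dvd cyclo p (1 + x) l - y ^ (p - 1) + (y ^ (p - 1) - (x ^ (p ^ l)) ^ (p - 1))"
    by (rule dvd_add)
  then show ?thesis
    by (simp add: power_mult)
qed

text \<open>The coefficientwise form of membership in the \<open>n\<close>-th power of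
  \<open>(p, q - 1)\<close>, which is generated by the \<open>p ^ (n - i) * (q - 1) ^ i\<close>.
  Truncated subtraction leaves the coefficients from \<open>n\<close> on unrestricted.\<close>

definition adic_coeffs :: "nat \<Rightarrow> nat \<Rightarrow> 'w::comm_ring_1 fps \<Rightarrow> bool" where
  "adic_coeffs p n d \<longleftrightarrow> (\<forall>i. of_nat p ^ (n - i) dvd fps_nth d i)"

lemma adic_coeffs_0_left [simp]: "adic_coeffs p 0 d"
  by (simp add: adic_coeffs_def)

lemma adic_coeffs_Suc:
  assumes "adic_coeffs p n d" "adic_coeffs p n e"
  shows "adic_coeffs p (Suc n) (of_nat p * d + fps_X * e)"
  unfolding adic_coeffs_def
proof
  fix i
  have "of_nat p ^ (Suc n - i) dvd of_nat p * fps_nth d i"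
  proof (cases "i \<le> n")
    case True
    then show ?thesis
      using assms(1) by (simp add: adic_coeffs_def Suc_diff_le mult_dvd_mono)
  qed simp
  moreover have "of_nat p ^ (Suc n - i) dvd fps_nth (fps_X * e) i"
  proof (cases i)
    case (Suc k)
    then show ?thesis
      using assms(2) by (simp add: adic_coeffs_def)
  qed simp
  ultimately show "of_nat p ^ (Suc n - i) dvd fps_nth (of_nat p * d + fps_X * e) i"
    by (simp add: fps_of_nat[symmetric])
qed

lemma adic_coeffs_imp_mem:
  assumes "adic_coeffs p n d"
  shows "d \<in> base_nbhd p n"
  using assms
proof (induction n arbitrary: d)
  case 0
  then show ?case
    by (simp add: base_nbhd_def)
next
  case (Suc n)
  let ?I = "ideal_gen {of_nat p, qv - 1} :: 'a fps set"
  have "adic_coeffs p n (fps_shift 1 d)"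
    unfolding adic_coeffs_def
  proof
    fix i
    show "of_nat p ^ (n - i) dvd fps_nth (fps_shift 1 d) i"
      using Suc.prems[unfolded adic_coeffs_def, rule_format, of "Suc i"] by simp
  qed
  then have "fps_X * fps_shift 1 d \<in> ideal_power ?I (Suc n)"
    using Suc.IH unfolding base_nbhd_def
    by (intro ideal_power_Suc_mem ideal_gen_base) (auto simp: qv_def)
  moreover obtain c where "fps_nth d 0 = of_nat p ^ Suc n * c"
    using Suc.prems[unfolded adic_coeffs_def, rule_format, of 0] by auto
  then have "fps_const (fps_nth d 0) = of_nat p ^ Suc n * fps_const c"
    by (simp add: fps_of_nat[symmetric] fps_const_power fps_const_mult del: power_Suc)
  then have "fps_const (fps_nth d 0) \<in> ideal_power ?I (Suc n)"
    using power_mult_mem_ideal_power[of "of_nat p" ?I "Suc n" "fps_const c"]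
    by (simp only: ideal_gen_base insertI1)
  moreover have "d = fps_const (fps_nth d 0) + fps_X * fps_shift 1 d"
    by (rule fps_ext) simp
  ultimately show ?case
    unfolding base_nbhd_def
    by (metis ring_module.subspace_add is_ideal_ideal_power)
qed

text \<open>Comparing coefficients at \<open>i + r\<close> expresses \<open>d\<close> at
  \<open>i\<close> through \<open>b * d\<close> and \<open>p\<close> times a combination of
  coefficients of \<open>d\<close> up to \<open>i + r\<close>. Each iteration gains a power of
  \<open>p\<close> and moves the index by \<open>r\<close>, which costs a factor
  \<open>Suc r\<close> in the exponent.\<close>

lemma adic_coeffs_cancel:
  fixes b d :: "'w::comm_ring_1 fps"
  assumes b: "of_nat p dvd b - fps_X ^ r" and bd: "adic_coeffs p (n * Suc r) (b * d)"
  shows "adic_coeffs p n d"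
proof -
  obtain h where "b - fps_X ^ r = of_nat p * h"
    using b by blast
  then have "b = fps_X ^ r + of_nat p * h"
    by (simp add: algebra_simps)
  then have coeff: "fps_nth (b * d) (i + r) = fps_nth d i + of_nat p * fps_nth (h * d) (i + r)" for i
    by (simp add: distrib_right mult.assoc fps_of_nat[symmetric] fps_X_power_mult_nth)
  have *: "of_nat p ^ e dvd fps_nth d i" if "i + e * Suc r \<le> n * Suc r" for e i
    using that
  proof (induction e arbitrary: i)
    case (Suc e)
    have "of_nat p ^ e dvd fps_nth (h * d) (i + r)"
      unfolding fps_mult_nth
    proof (rule dvd_sum)
      fix j
      assume "j \<in> {0..i + r}"
      then have "i + r - j + e * Suc r \<le> n * Suc r"
        using Suc.prems by simp
      then show "of_nat p ^ e dvd fps_nth h j * fps_nth d (i + r - j)"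
        using Suc.IH by simp
    qed
    then have "of_nat p ^ Suc e dvd of_nat p * fps_nth (h * d) (i + r)"
      by (simp add: mult_dvd_mono)
    moreover have "of_nat p ^ Suc e dvd fps_nth (b * d) (i + r)"
    proof (rule dvd_trans)
      show "of_nat p ^ Suc e dvd (of_nat p ^ (n * Suc r - (i + r)) :: 'w)"
        using Suc.prems by (intro le_imp_power_dvd) simp
      show "of_nat p ^ (n * Suc r - (i + r)) dvd fps_nth (b * d) (i + r)"
        using bd by (simp add: adic_coeffs_def)
    qed
    ultimately show ?case
      using dvd_diff[of "of_nat p ^ Suc e" "fps_nth (b * d) (i + r)" "of_nat p * fps_nth (h * d) (i + r)"]
      by (simp add: coeff)
  qed simp
  have "i + (n - i) * Suc r \<le> n * Suc r" if "i \<le> n" for i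
  proof -
    have "i + (n - i) * Suc r \<le> i * Suc r + (n - i) * Suc r"
      by simp
    also have "\<dots> = n * Suc r"
      using that by (metis add_mult_distrib le_add_diff_inverse)
    finally show ?thesis .
  qed
  then show ?thesis
    unfolding adic_coeffs_def using * by (metis le_cases diff_is_0_eq power_0 one_dvd)
qed

text \<open>\<open>W\<close> may have torsion, so universal divisibilities are proved over
  \<open>\<int>[[q - 1]]\<close> and transported along this map.\<close>

definition int_fps_map :: "int fps \<Rightarrow> 'w::comm_ring_1 fps" where
  "int_fps_map f = Abs_fps (\<lambda>n. of_int (fps_nth f n))"

lemma is_ring_hom_int_fps_map: "is_ring_hom int_fps_map"
  unfolding is_ring_hom_def int_fps_map_def
  by (auto intro!: fps_ext simp: fps_mult_nth)

interpretation int_fps_map: ring_homo int_fps_map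
  by unfold_locales (rule is_ring_hom_int_fps_map)

lemma int_fps_map_qv [simp]: "int_fps_map qv = qv"
  unfolding qv_def int_fps_map_def by (rule fps_ext) (simp add: fps_X_def)

text \<open>The denominators \<open>(p)\<^sub>q\<^sup>k (k)\<^bsub>q^p\<^esub>!\<close> of the twisted divided powers.\<close>
definition dp_denom :: "nat \<Rightarrow> 'a::comm_ring_1 \<Rightarrow> nat \<Rightarrow> 'a" where
  "dp_denom p t k = (\<Prod>j<k. q_int t (p * Suc j))"

lemma dp_denom_0 [simp]: "dp_denom p t 0 = 1"
  and dp_denom_Suc: "dp_denom p t (Suc k) = dp_denom p t k * q_int t (p * Suc k)"
  by (simp_all add: dp_denom_def)

lemma (in ring_homo) dp_denom [simp]: "f (dp_denom p t k) = dp_denom p (f t) k"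
  by (simp add: dp_denom_def prod)

lemma dp_denom_mult_power:
  "dp_denom p t k * (t - 1) ^ k = (\<Prod>j<k. (t ^ p) ^ Suc j - 1)"
proof -
  have "(\<Prod>j<k. (t ^ p) ^ Suc j - 1) = (\<Prod>j<k. (t - 1) * q_int t (p * Suc j))"
    by (intro prod.cong refl) (simp only: power_diff_one_eq_q_int flip: power_mult)
  also have "\<dots> = dp_denom p t k * (t - 1) ^ k"
    by (simp add: prod.distrib dp_denom_def)
  finally show ?thesis ..
qed

text \<open>Division by \<open>q - 1\<close> is legitimate because \<open>D\<close> has a nonzero constant term; this is the
  point where torsion-free coefficients are needed.\<close>
lemma newton_coeff_dvd:
  fixes c :: "nat \<Rightarrow> int fps"
  assumes g: "\<And>m. g m = (\<Sum>k<K. c k * (\<Prod>i<k. qv ^ (p * m + 1) - qv ^ (p * i + 1)))"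
    and D: "\<And>m. fps_X ^ n * D dvd g m" "fps_nth D 0 \<noteq> 0" and "k < K"
  shows "D dvd c k * dp_denom p qv k"
proof -
  define q :: "int fps" where "q = qv"
  have q1: "q - 1 = fps_X"
    by (simp add: q_def qv_def)
  define Pk where "Pk k m = (\<Prod>i<k. q ^ (p * m + 1) - q ^ (p * i + 1))" for k m
  have Pk: "Pk k m = q ^ k * (\<Prod>i<k. (q ^ p) ^ m - (q ^ p) ^ i)" for k m
  proof -
    have "Pk k m = (\<Prod>i<k. q * ((q ^ p) ^ m - (q ^ p) ^ i))"
      by (simp add: Pk_def power_mult right_diff_distrib)
    then show ?thesis
      by (simp add: prod.distrib)
  qed
  have dvd_Pk: "dp_denom p q k * fps_X ^ k dvd Pk k m" for k m
    using dp_denom_mult_power[of p q k] prod_power_diff_dvd[where t = "q ^ p" and i = k and m = m]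
    by (simp add: Pk q1 dvd_mult)
  have Pk_diag: "\<exists>N. Pk k k = q ^ N * (dp_denom p q k * fps_X ^ k)" for k
  proof -
    obtain N where "(\<Prod>i<k. (q ^ p) ^ k - (q ^ p) ^ i) = (q ^ p) ^ N * (\<Prod>j<k. (q ^ p) ^ Suc j - 1)"
      using prod_power_diff_self[where t = "q ^ p" and k = k] by blast
    then have "Pk k k = q ^ (k + p * N) * (dp_denom p q k * fps_X ^ k)"
      using dp_denom_mult_power[of p q k] by (simp add: Pk q1 power_add power_mult mult.assoc)
    then show ?thesis
      by blast
  qed
  have Pk_0: "Pk k m = 0" if "m < k" for k m
    using that unfolding Pk_def by (intro prod_zero) auto
  have q_unit: "q dvd 1"
  proof
    show "1 = q * Abs_fps (\<lambda>n. (- 1) ^ n)"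
      unfolding q_def qv_def
      by (rule fps_ext) (simp add: distrib_right power_eq_if)
  qed
  \<comment> \<open>Evaluation at node \<open>k\<close>: the products of index above
    \<open>k\<close> vanish there, those below are controlled by induction, and the one at
    \<open>k\<close> is \<open>dp_denom p q k * fps_X ^ k\<close> up to a power of the unit
    \<open>q\<close>.\<close>
  have *: "fps_X ^ n * D dvd c k * (dp_denom p q k * fps_X ^ k)" if "k < K" for k
    using that
  proof (induction k rule: less_induct)
    case (less k)
    have "g k = (\<Sum>i<K. c i * Pk i k)"
      by (simp add: g Pk_def q_def)
    also have "\<dots> = (\<Sum>i<Suc k. c i * Pk i k)"
      using less.prems by (intro sum.mono_neutral_right) (auto simp: Pk_0)
    finally have "c k * Pk k k = g k - (\<Sum>i<k. c i * Pk i k)"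
      by simp
    also have "fps_X ^ n * D dvd \<dots>"
    proof (intro dvd_diff D(1) dvd_sum)
      fix i
      assume "i \<in> {..<k}"
      then have "fps_X ^ n * D dvd c i * (dp_denom p q i * fps_X ^ i)"
        using less by simp
      also have "\<dots> dvd c i * Pk i k"
        by (intro mult_dvd_mono dvd_refl dvd_Pk)
      finally show "fps_X ^ n * D dvd c i * Pk i k" .
    qed
    finally have dvd: "fps_X ^ n * D dvd c k * Pk k k" .
    obtain N where N: "Pk k k = q ^ N * (dp_denom p q k * fps_X ^ k)"
      using Pk_diag by blast
    obtain r where r: "q ^ N * r = 1"
      using q_unit by (metis dvd_def power_mult_distrib power_one)
    have "c k * (dp_denom p q k * fps_X ^ k) = (q ^ N * r) * (c k * (dp_denom p q k * fps_X ^ k))"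
      by (simp add: r)
    also have "\<dots> = c k * Pk k k * r"
      by (simp only: N mult_ac)
    finally show ?case
      using dvd by (metis dvd_mult2)
  qed
  \<comment> \<open>Over the integers the nonzero constant term of \<open>D\<close> forces
    \<open>fps_X\<close> to divide the cofactor, so powers of \<open>fps_X\<close> cancel one at a
    time.\<close>
  have cancel: "D dvd y" if "D dvd y * fps_X ^ e" for y e
    using that
  proof (induction e)
    case (Suc e)
    then obtain r where r: "y * fps_X ^ Suc e = D * r"
      by blast
    then have "fps_nth D 0 * fps_nth r 0 = 0"
      by (metis fps_mult_nth_0 fps_X_nth power_Suc mult_zero_left mult_zero_right
          zero_neq_one)
    then have r0: "fps_nth r 0 = 0"
      using D(2) by simp
    have "fps_nth r n = fps_nth (fps_X * fps_shift 1 r) n" for n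
      by (cases n) (simp_all add: r0)
    then have "\<exists>r'. r = fps_X * r'"
      by (blast intro: fps_ext)
    then obtain r' where "r = fps_X * r'" ..
    with r have "fps_X * (y * fps_X ^ e) = fps_X * (D * r')"
      by (simp add: mult_ac)
    then have "y * fps_X ^ e = D * r'"
      by simp
    then show ?case
      using Suc.IH by simp
  qed simp
  have "D dvd c k * dp_denom p q k * fps_X ^ k"
    using dvd_mult_right[OF *[OF \<open>k < K\<close>]] by (simp only: mult.assoc)
  then show ?thesis
    unfolding q_def by (rule cancel)
qed

lemma two_times_sum_lessThan: "2 * (\<Sum>i<n. i) = n * (n - 1 :: nat)"
  by (induction n) (auto simp: algebra_simps)

lemma q_binomial_1: "q_binomial t n (Suc 0) = q_int t n"
proof (induction n)
  case (Suc n)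
  have "q_int t (Suc n) = 1 + t * q_int t n"
    by (simp add: q_int_def sum.lessThan_Suc_shift sum_distrib_left del: sum.lessThan_Suc)
  with Suc show ?case
    by simp
qed simp

lemma q_int_diff:
  fixes x y :: "'a::comm_ring_1"
  shows "q_int y n - q_int x n = (y - x) * (\<Sum>i<n. \<Sum>j<i. x ^ (i - Suc j) * y ^ j)"
  by (simp only: q_int_def sum_subtractf[symmetric] power_diff_sumr2 sum_distrib_left)

lemma int_fps_nth_0_hom: "ring_homo (\<lambda>f :: int fps. fps_nth f 0)"
  by unfold_locales (simp add: is_ring_hom_def)

lemma q_int_qv_nth_0: "fps_nth (q_int qv n :: int fps) 0 = int n"
proof -
  interpret ring_homo "\<lambda>f :: int fps. fps_nth f 0"
    by (rule int_fps_nth_0_hom)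
  show ?thesis
    by (simp add: q_int_def qv_def sum)
qed

text \<open>At \<open>q = 1\<close> every cyclotomic factor takes the value
  \<open>p\<close>.\<close>

lemma prod_p_part_nth_0:
  assumes "p > 0"
  shows "fps_nth (\<Prod>j<n::nat. p_part p qv L (e j) :: int fps) 0 \<noteq> 0"
proof -
  interpret ring_homo "\<lambda>f :: int fps. fps_nth f 0"
    by (rule int_fps_nth_0_hom)
  show ?thesis
    using assms by (auto simp: prod p_part_def cyclo_def q_int_def qv_def sum)
qed

lemma (in ring_homo) cyclo [simp]: "f (cyclo p t l) = cyclo p (f t) l"
  by (simp add: cyclo_def)

lemma (in ring_homo) p_part [simp]: "f (p_part p t L e) = p_part p (f t) L e"
  by (simp add: p_part_def prod)

section \<open>Newton sums at the nodes \<open>qv ^ (p * i + 1)\<close>\<close>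

definition newton_sum ::
  "nat \<Rightarrow> (int fps \<Rightarrow> 'a::comm_ring_1) \<Rightarrow> (nat \<Rightarrow> int fps) \<Rightarrow> nat \<Rightarrow> 'a \<Rightarrow> 'a" where
  "newton_sum p f c K x = (\<Sum>k<K. f (c k) * (\<Prod>i<k. x - f (qv ^ (p * i + 1))))"

lemma newton_sum_extend:
  assumes "is_ring_hom f" "\<forall>k\<ge>K. c k = 0" "K \<le> K'"
  shows "newton_sum p f c K' x = newton_sum p f c K x"
proof -
  interpret ring_homo f
    by unfold_locales (rule assms)
  show ?thesis
    unfolding newton_sum_def
    by (rule sum.mono_neutral_right) (use assms in auto)
qed

lemma newton_sum_add:
  assumes "is_ring_hom f"
  shows "newton_sum p f (\<lambda>k. c k + d k) K x = newton_sum p f c K x + newton_sum p f d K x"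
proof -
  interpret ring_homo f
    by unfold_locales (rule assms)
  show ?thesis
    by (simp add: newton_sum_def sum.distrib distrib_right)
qed

lemma newton_sum_scale:
  assumes "is_ring_hom f"
  shows "newton_sum p f (\<lambda>k. r * c k) K x = f r * newton_sum p f c K x"
proof -
  interpret ring_homo f
    by unfold_locales (rule assms)
  show ?thesis
    by (simp add: newton_sum_def sum_distrib_left mult.assoc)
qed

text \<open>Write \<open>x\<close> as the \<open>k\<close>-th node plus the difference of
  \<open>x\<close> and that node: the first summand scales the \<open>k\<close>-th coefficient, the
  second moves it to place \<open>k + 1\<close>.\<close>

lemma newton_sum_mult:
  assumes "is_ring_hom f" "c K = 0"
  shows "newton_sum p f (\<lambda>k. c k * qv ^ (p * k + 1) + (case k of 0 \<Rightarrow> 0 | Suc i \<Rightarrow> c i)) (Suc K) x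
    = x * newton_sum p f c K x"
proof -
  interpret ring_homo f
    by unfold_locales (rule assms)
  define b where "b k = (\<Prod>i<k. x - f (qv ^ (p * i + 1)))" for k
  have b: "f (qv ^ (p * k + 1)) * b k + b (Suc k) = x * b k" for k
    by (simp add: b_def algebra_simps)
  have "newton_sum p f (\<lambda>k. c k * qv ^ (p * k + 1) + (case k of 0 \<Rightarrow> 0 | Suc i \<Rightarrow> c i)) (Suc K) x
    = (\<Sum>k<Suc K. f (c k) * f (qv ^ (p * k + 1)) * b k) +
      (\<Sum>k<Suc K. f (case k of 0 \<Rightarrow> 0 | Suc i \<Rightarrow> c i) * b k)"
    unfolding newton_sum_def b_def[symmetric] by (simp add: sum.distrib distrib_right)
  also have "(\<Sum>k<Suc K. f (c k) * f (qv ^ (p * k + 1)) * b k) =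
      (\<Sum>k<K. f (c k) * f (qv ^ (p * k + 1)) * b k)"
    by (simp add: assms(2))
  also have "(\<Sum>k<Suc K. f (case k of 0 \<Rightarrow> 0 | Suc i \<Rightarrow> c i) * b k) = (\<Sum>k<K. f (c k) * b (Suc k))"
    by (subst sum.lessThan_Suc_shift) simp
  also have "(\<Sum>k<K. f (c k) * f (qv ^ (p * k + 1)) * b k) + (\<Sum>k<K. f (c k) * b (Suc k)) =
      (\<Sum>k<K. f (c k) * (f (qv ^ (p * k + 1)) * b k + b (Suc k)))"
    by (simp only: distrib_left sum.distrib mult.assoc)
  also have "\<dots> = x * newton_sum p f c K x"
    unfolding b newton_sum_def b_def[symmetric] by (simp add: sum_distrib_left mult_ac)
  finally show ?thesis .
qed

section \<open>The algebra of twisted divided powers\<close>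

locale dp_completion =
  fixes p :: nat
    and s :: "'w::comm_ring_1 fps \<Rightarrow> 'a::comm_ring_1"
    and w :: "nat \<Rightarrow> 'a"
    and \<iota> :: "'a \<Rightarrow> 'h::comm_ring_1"
    and pr :: "nat \<Rightarrow> 'h \<Rightarrow> 'a set"
    and \<theta> :: "'w fps \<Rightarrow> 'h"
  assumes prime: "prime p"
    and algebra: "twisted_dp_algebra p s w"
    and completed: "adic_completion (ideal_gen {of_nat p, s (qv - 1)}) \<iota> pr"
    and taylor: "taylor_map p s w \<iota> pr \<theta>"
begin

sublocale s: ring_homo s
  using algebra by unfold_locales (simp add: twisted_dp_algebra_def)

sublocale theta: ring_homo \<theta>
  using taylor by unfold_locales (simp add: taylor_map_def)

abbreviation I where "I \<equiv> ideal_gen {of_nat p, s qv - 1}"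

sublocale completion I \<iota> pr
  by unfold_locales (use completed in simp_all)

definition q' :: 'a where
  "q' = s qv + s (q_int qv p) * w 1"

lemma theta_qv: "\<theta> qv = \<iota> q'"
  using taylor by (simp add: taylor_map_def q'_def)

lemma theta_const: "\<theta> (fps_const a) = \<iota> (s (fps_const a))"
  using taylor by (simp add: taylor_map_def)

lemma p_in_I: "of_nat p \<in> I"
  and s_in_I: "s qv - 1 \<in> I"
  by (auto intro: ideal_gen_base)

lemma of_nat_in_I: "p dvd n \<Longrightarrow> of_nat n \<in> I"
  using ideal_mult_right[OF ideal_I p_in_I] by (auto elim!: dvdE)

lemma q'_in_I: "q' - 1 \<in> I"
proof -
  have "s (q_int qv p) - of_nat p + of_nat p \<in> I"
    using q_int_diff_of_nat_mem[OF ideal_I s_in_I, of p] p_in_I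
    by (intro ring_module.subspace_add[OF ideal_I]) simp_all
  then have "(s qv - 1) + s (q_int qv p) * w 1 \<in> I"
    using s_in_I by (intro ring_module.subspace_add[OF ideal_I] ideal_mult_right[OF ideal_I]) simp_all
  then show ?thesis
    by (simp add: q'_def algebra_simps)
qed

subsection \<open>Coordinates\<close>

definition coord :: "'a \<Rightarrow> nat \<Rightarrow> 'w fps" where
  "coord a = (THE c. finite {n. c n \<noteq> 0} \<and> a = (\<Sum>n | c n \<noteq> 0. s (c n) * w n))"

lemma coord_ex1: "\<exists>!c. finite {n. c n \<noteq> 0} \<and> a = (\<Sum>n | c n \<noteq> 0. s (c n) * w n)"
  using algebra unfolding twisted_dp_algebra_def by blast

lemma finite_coord: "finite {n. coord a n \<noteq> 0}"
  and sum_coord: "a = (\<Sum>n | coord a n \<noteq> 0. s (coord a n) * w n)"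
  using theI'[OF coord_ex1[of a]] unfolding coord_def by blast+

lemma coord_eqI:
  assumes "finite F" "\<And>n. n \<notin> F \<Longrightarrow> c n = 0" "a = (\<Sum>n\<in>F. s (c n) * w n)"
  shows "coord a = c"
  unfolding coord_def
proof (rule the1_equality[OF coord_ex1], intro conjI)
  have sub: "{n. c n \<noteq> 0} \<subseteq> F"
    using assms(2) by blast
  then show "finite {n. c n \<noteq> 0}"
    using assms(1) by (rule finite_subset)
  have "(\<Sum>n | c n \<noteq> 0. s (c n) * w n) = (\<Sum>n\<in>F. s (c n) * w n)"
    by (rule sum.mono_neutral_left[OF assms(1) sub]) simp
  then show "a = (\<Sum>n | c n \<noteq> 0. s (c n) * w n)"
    using assms(3) by simp
qed

lemma coord_sum:
  assumes "finite F" "\<And>n. n \<notin> F \<Longrightarrow> coord a n = 0"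
  shows "a = (\<Sum>n\<in>F. s (coord a n) * w n)"
proof -
  have "(\<Sum>n | coord a n \<noteq> 0. s (coord a n) * w n) = (\<Sum>n\<in>F. s (coord a n) * w n)"
    by (rule sum.mono_neutral_left) (use assms in auto)
  then show ?thesis
    using sum_coord[of a] by simp
qed

lemma coord_add: "coord (a + b) = (\<lambda>n. coord a n + coord b n)"
proof (rule coord_eqI)
  let ?F = "{n. coord a n \<noteq> 0} \<union> {n. coord b n \<noteq> 0}"
  show F: "finite ?F"
    by (simp add: finite_coord)
  show "a + b = (\<Sum>n\<in>?F. s (coord a n + coord b n) * w n)"
    using coord_sum[OF F, of a] coord_sum[OF F, of b] by (simp add: distrib_right sum.distrib)
qed auto

lemma coord_scale: "coord (s r * a) = (\<lambda>n. r * coord a n)"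
proof (rule coord_eqI)
  show "finite {n. coord a n \<noteq> 0}"
    by (rule finite_coord)
  show "s r * a = (\<Sum>n | coord a n \<noteq> 0. s (r * coord a n) * w n)"
    using sum_coord[of a] by (simp add: sum_distrib_left mult.assoc[symmetric])
      (metis (no_types, lifting) sum.cong sum_distrib_left mult.assoc)
qed auto

lemma coord_w: "coord (w k) = (\<lambda>n. if n = k then 1 else 0)"
  by (rule coord_eqI[of "{k}"]) auto

lemma span_induct_w [case_names add scale]:
  assumes "\<And>a b. Q a \<Longrightarrow> Q b \<Longrightarrow> Q (a + b)" "\<And>r n. Q (s r * w n)"
  shows "Q a"
proof -
  have Q0: "Q 0"
    using assms(2)[of 0 0] by simp
  have "Q (\<Sum>n\<in>F. s (c n) * w n)" if "finite F" for F c
    using that by (induction F rule: finite_induct) (simp_all add: assms Q0)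
  then show ?thesis
    using finite_coord[of a] sum_coord[of a] by metis
qed

text \<open>The algebra is free over \<open>R\<close> and \<open>I\<close> is generated by elements
  of \<open>R\<close>, so its powers can be tested on coordinates;
  \<open>mem_P_if_adic_coeffs\<close> is the converse.\<close>

lemma adic_coeffs_coord: "x \<in> P n \<Longrightarrow> adic_coeffs p n (coord x k)"
proof (induction n arbitrary: x)
  case (Suc n)
  then obtain y z where yz: "y \<in> P n" "z \<in> P n" "x = of_nat p * y + (s qv - 1) * z"
    using ideal_power_pair by metis
  have "x = s (of_nat p) * y + s (qv - 1) * z"
    using yz by simp
  then have "coord x k = of_nat p * coord y k + fps_X * coord z k"
    by (simp only: coord_add coord_scale) (simp add: qv_def)
  with yz Suc.IH show ?case
    by (simp add: adic_coeffs_Suc)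
qed simp

lemma s_base_nbhd: "r \<in> base_nbhd p n \<Longrightarrow> s r \<in> P n"
  unfolding base_nbhd_def by (rule s.ideal_power_mem) (auto intro: ideal_gen_base)

lemma mem_P_if_adic_coeffs:
  assumes "\<And>k. adic_coeffs p n (coord x k)"
  shows "x \<in> P n"
proof -
  have "(\<Sum>k | coord x k \<noteq> 0. s (coord x k) * w k) \<in> P n"
    using assms
    by (intro ring_module.subspace_sum ideal_mult_right is_ideal_ideal_power s_base_nbhd
        adic_coeffs_imp_mem)
  then show ?thesis
    using sum_coord[of x] by simp
qed

subsection \<open>Regular elements and units\<close>

text \<open>Cancellation of \<open>b\<close> works coordinatewise on representatives, and the
  completion is separated. Representatives are taken at precision \<open>n * Suc r\<close> to absorb
  the loss in \<open>adic_coeffs_cancel\<close>.\<close>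

lemma regular_iota_s:
  assumes b: "of_nat p dvd b - fps_X ^ r" and zero: "\<iota> (s b) * h = 0"
  shows "h = 0"
proof (rule N_separated)
  fix n
  obtain x where x: "approx h (n * Suc r) x"
    by (rule approx_exists)
  have "approx (\<iota> (s b) * h) (n * Suc r) (s b * x)"
    by (intro approx_mult approx_iota x)
  moreover have "\<iota> (s b) * h \<in> N (n * Suc r)"
    using ring_module.subspace_0[OF is_ideal_N] by (simp add: zero)
  ultimately have "s b * x \<in> P (n * Suc r)"
    using approx_mem_N by blast
  then have "adic_coeffs p (n * Suc r) (b * coord x k)" for k
    using adic_coeffs_coord[of "s b * x" "n * Suc r" k] by (simp only: coord_scale)
  then have "adic_coeffs p n (coord x k)" for k
    by (rule adic_coeffs_cancel[OF b])
  then have "x \<in> P n"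
    by (rule mem_P_if_adic_coeffs)
  moreover have "approx h n x"
    using x by (rule approx_antimono) simp
  ultimately show "h \<in> N n"
    using approx_mem_N by blast
qed

lemma regular_cyclo: "\<iota> (s (cyclo p qv l)) * h = 0 \<Longrightarrow> h = 0"
  using regular_iota_s[OF prime_dvd_cyclo[OF prime, of fps_X l]] by (simp only: qv_def)

text \<open>Modulo \<open>I\<close> the \<open>q\<close>-integer is \<open>c\<close>, and an inverse
  \<open>r\<close> of \<open>c\<close> modulo \<open>p\<close> makes its product with
  \<open>r\<close> congruent to 1.\<close>

lemma unit_q_int:
  assumes "x - 1 \<in> I" "\<not> p dvd c"
  shows "\<iota> (q_int x c) dvd 1"
proof -
  have "coprime c p"
    using prime_imp_coprime[OF prime assms(2)] by (simp add: coprime_commute)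
  then obtain r where r: "[c * r = 1] (mod p)"
    using cong_solve_coprime_nat by auto
  then have "(c * r) mod p = 1"
    using prime_gt_1_nat[OF prime] by (simp add: cong_def)
  then have "c * r = p * ((c * r) div p) + 1"
    by (metis mult_div_mod_eq)
  then have "of_nat (c * r) - 1 = (of_nat (p * ((c * r) div p)) :: 'a)"
    by (metis add_diff_cancel_right' of_nat_1 of_nat_add)
  then have "of_nat (c * r) - 1 \<in> I"
    using of_nat_in_I[of "p * ((c * r) div p)"] by (simp only: dvd_triv_left)
  moreover have "(q_int x c - of_nat c) * of_nat r \<in> I"
    by (intro ideal_mult_right ideal_I q_int_diff_of_nat_mem assms)
  ultimately have "(q_int x c - of_nat c) * of_nat r + (of_nat (c * r) - 1) \<in> I"
    by (intro ring_module.subspace_add ideal_I)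
  then have "q_int x c * of_nat r - 1 \<in> I"
    by (simp add: algebra_simps)
  then have "\<iota> (q_int x c * of_nat r) dvd 1"
    by (rule iota_unit)
  then show ?thesis
    by (simp only: iota.mult dvd_mult_left)
qed

subsection \<open>The Newton basis\<close>

lemma w_0: "w 0 = 1"
  using algebra by (simp add: twisted_dp_algebra_def)

lemma w_1_mult: "w 1 * w n = s (q_int (qv ^ p) (Suc n)) * w (Suc n)
    + s (q_int (qv ^ p) n * (qv - 1) * qv) * w n"
proof -
  have "w 1 * w n = (\<Sum>i\<le>min 1 n.
           s (qv ^ (p * i * (i - 1) div 2)
              * q_binomial (qv ^ p) (1 + n - i) 1 * q_binomial (qv ^ p) 1 i
              * (qv - 1) ^ i * qv ^ i)
           * w (1 + n - i))"
    using algebra unfolding twisted_dp_algebra_def by blast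
  then show ?thesis
    by (cases n) (simp_all add: q_binomial_1 w_0 del: q_binomial.simps(3))
qed

text \<open>After scaling by \<open>(p)_q\<close>, the coefficient of \<open>w n\<close> in
  \<open>w 1 * w n\<close> is \<open>q ^ (p * n + 1) - q\<close>. Subtracting the node
  \<open>q ^ (p * n + 1)\<close> from \<open>q'\<close> cancels it, which explains the choice of
  nodes.\<close>

lemma newton_step:
  "(q' - s (qv ^ (p * n + 1))) * w n = s (q_int qv (p * Suc n)) * w (Suc n)"
proof -
  have "q_int qv p * (q_int (qv ^ p) n * (qv - 1) * qv) = (qv ^ (p * n) - 1) * qv"
    unfolding power_diff_one_eq_q_int q_int_mult by (simp only: mult_ac)
  then have "s (q_int qv p) * s (q_int (qv ^ p) n * (qv - 1) * qv) = s ((qv ^ (p * n) - 1) * qv)"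
    by (metis s.mult)
  moreover have "s (q_int qv p) * s (q_int (qv ^ p) (Suc n)) = s (q_int qv (p * Suc n))"
    by (simp only: q_int_mult s.mult)
  moreover have "(q' - s (qv ^ (p * n + 1))) * w n =
      s (q_int qv p) * s (q_int (qv ^ p) (Suc n)) * w (Suc n)
      + (s (q_int qv p) * s (q_int (qv ^ p) n * (qv - 1) * qv) + s qv - s (qv ^ (p * n + 1))) * w n"
  proof -
    have "(q' - s (qv ^ (p * n + 1))) * w n =
        s (q_int qv p) * (w 1 * w n) + (s qv - s (qv ^ (p * n + 1))) * w n"
      by (simp only: q'_def) (simp add: algebra_simps)
    then show ?thesis
      unfolding w_1_mult by (simp only: distrib_left distrib_right add_diff_eq[symmetric] mult.assoc add.assoc)
  qed
  ultimately show ?thesis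
    by (simp add: algebra_simps)
qed

lemma newton_basis: "(\<Prod>i<k. q' - s (qv ^ (p * i + 1))) = s (dp_denom p qv k) * w k"
proof (induction k)
  case (Suc k)
  have "(\<Prod>i<Suc k. q' - s (qv ^ (p * i + 1))) =
      (s (dp_denom p qv k) * w k) * (q' - s (qv ^ (p * k + 1)))"
    by (simp only: prod.lessThan_Suc Suc)
  also have "\<dots> = s (dp_denom p qv k) * ((q' - s (qv ^ (p * k + 1))) * w k)"
    by (simp only: mult_ac)
  finally have "(\<Prod>i<Suc k. q' - s (qv ^ (p * i + 1))) =
      s (dp_denom p qv k) * ((q' - s (qv ^ (p * k + 1))) * w k)" .
  then show ?case
    by (simp only: newton_step dp_denom_Suc s.mult mult.assoc)
qed (simp add: w_0)

definition rep :: "int fps \<Rightarrow> 'a" where "rep f = s (int_fps_map f)"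

lemma is_ring_hom_rep: "is_ring_hom rep"
  unfolding rep_def by (rule is_ring_hom_comp) (rule is_ring_hom_int_fps_map s.is_hom)+

sublocale rep: ring_homo rep
  by unfold_locales (rule is_ring_hom_rep)

lemma rep_qv [simp]: "rep qv = s qv"
  by (simp add: rep_def)

text \<open>\<open>newton_rel x g\<close> says that \<open>x\<close> is the value at \<open>q'\<close> of a polynomial with coefficients
  in \<open>\<int>[[q - 1]]\<close> whose value at \<open>q\<^bsup>pm+1\<^esup>\<close> is \<open>g m\<close>.\<close>
definition newton_rel :: "'a \<Rightarrow> (nat \<Rightarrow> int fps) \<Rightarrow> bool" where
  "newton_rel x g \<longleftrightarrow> (\<exists>K c. (\<forall>k\<ge>K. c k = 0) \<and> x = newton_sum p rep c K q' \<and>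
     (\<forall>m. g m = newton_sum p (\<lambda>r. r) c K (qv ^ (p * m + 1))))"

lemma is_ring_hom_id: "is_ring_hom (\<lambda>r. r)"
  by (simp add: is_ring_hom_def)

lemma newton_rel_const: "newton_rel (rep r) (\<lambda>m. r)"
  unfolding newton_rel_def
  by (rule exI[of _ "Suc 0"], rule exI[of _ "\<lambda>k. if k = 0 then r else 0"]) (simp add: newton_sum_def)

lemma newton_rel_scale: "newton_rel x g \<Longrightarrow> newton_rel (rep r * x) (\<lambda>m. r * g m)"
  unfolding newton_rel_def
proof (elim exE conjE)
  fix K c
  assume *: "\<forall>k\<ge>K. c k = 0" "x = newton_sum p rep c K q'"
    "\<forall>m. g m = newton_sum p (\<lambda>r. r) c K (qv ^ (p * m + 1))"
  show "\<exists>K c. (\<forall>k\<ge>K. c k = 0) \<and> rep r * x = newton_sum p rep c K q' \<and>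
     (\<forall>m. r * g m = newton_sum p (\<lambda>r. r) c K (qv ^ (p * m + 1)))"
    by (rule exI[of _ K], rule exI[of _ "\<lambda>k. r * c k"])
      (use * in \<open>simp add: newton_sum_scale[OF is_ring_hom_rep] newton_sum_scale[OF is_ring_hom_id]\<close>)
qed

lemma newton_rel_add:
  assumes "newton_rel x g" "newton_rel y h"
  shows "newton_rel (x + y) (\<lambda>m. g m + h m)"
proof -
  obtain K c where c: "\<forall>k\<ge>K. c k = 0" "x = newton_sum p rep c K q'"
    "\<forall>m. g m = newton_sum p (\<lambda>r. r) c K (qv ^ (p * m + 1))"
    using assms(1) unfolding newton_rel_def by blast
  obtain L d where d: "\<forall>k\<ge>L. d k = 0" "y = newton_sum p rep d L q'"
    "\<forall>m. h m = newton_sum p (\<lambda>r. r) d L (qv ^ (p * m + 1))"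
    using assms(2) unfolding newton_rel_def by blast
  let ?M = "max K L"
  have "newton_sum p rep c ?M t = newton_sum p rep c K t"
    "newton_sum p rep d ?M t = newton_sum p rep d L t"
    "newton_sum p (\<lambda>r. r) c ?M u = newton_sum p (\<lambda>r. r) c K u"
    "newton_sum p (\<lambda>r. r) d ?M u = newton_sum p (\<lambda>r. r) d L u" for t u
    using c(1) d(1)
    by (auto intro!: newton_sum_extend[OF is_ring_hom_rep] newton_sum_extend[OF is_ring_hom_id])
  with c d show ?thesis
    unfolding newton_rel_def
    by (intro exI[of _ ?M] exI[of _ "\<lambda>k. c k + d k"])
      (simp add: newton_sum_add[OF is_ring_hom_rep] newton_sum_add[OF is_ring_hom_id])
qed

lemma newton_rel_mult_q':
  assumes "newton_rel x g"
  shows "newton_rel (q' * x) (\<lambda>m. qv ^ (p * m + 1) * g m)"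
proof -
  obtain K c where c: "\<forall>k\<ge>K. c k = 0" "x = newton_sum p rep c K q'"
    "\<forall>m. g m = newton_sum p (\<lambda>r. r) c K (qv ^ (p * m + 1))"
    using assms(1) unfolding newton_rel_def by blast
  define d where "d k = c k * qv ^ (p * k + 1) + (case k of 0 \<Rightarrow> 0 | Suc i \<Rightarrow> c i)" for k
  have "d k = 0" if "k \<ge> Suc K" for k
    using that c(1) by (cases k) (simp_all add: d_def)
  moreover have "newton_sum p rep d (Suc K) q' = q' * x"
    unfolding d_def using c newton_sum_mult[OF is_ring_hom_rep, of c K p q'] by simp
  moreover have "newton_sum p (\<lambda>r. r) d (Suc K) u = u * newton_sum p (\<lambda>r. r) c K u" for u
    unfolding d_def using c newton_sum_mult[OF is_ring_hom_id, of c K p u] by simp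
  ultimately show ?thesis
    unfolding newton_rel_def using c(3) by (intro exI[of _ "Suc K"] exI[of _ d]) simp
qed

lemma newton_rel_mult_q'_power:
  "newton_rel x g \<Longrightarrow> newton_rel (q' ^ e * x) (\<lambda>m. (qv ^ (p * m + 1)) ^ e * g m)"
proof (induction e)
  case (Suc e)
  then show ?case
    using newton_rel_mult_q'[of "q' ^ e * x"] by (simp only: power_Suc mult.assoc)
qed simp

lemma newton_rel_mult_diff:
  assumes "newton_rel x g"
  shows "newton_rel ((rep r - q' ^ e) * x) (\<lambda>m. (r - (qv ^ (p * m + 1)) ^ e) * g m)"
  using newton_rel_add[OF newton_rel_scale[OF assms, of r]
      newton_rel_scale[OF newton_rel_mult_q'_power[OF assms, of e], of "- 1"]]
  by (simp only: rep.minus rep.one mult_minus_left mult_1_left left_diff_distrib add_uminus_conv_diff)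

text \<open>By \<open>newton_coeff_dvd\<close>, \<open>D\<close> divides each coefficient times
  \<open>dp_denom p qv k\<close>. In the algebra this factor is supplied by the Newton basis, whose
  products are \<open>dp_denom p qv k\<close> times \<open>w k\<close>.\<close>

lemma newton_rel_dvd:
  assumes "newton_rel x g" "\<And>m. fps_X ^ n * D dvd g m" "fps_nth D 0 \<noteq> 0"
  shows "rep D dvd x"
proof -
  obtain K c where c: "x = newton_sum p rep c K q'"
    "\<And>m. g m = newton_sum p (\<lambda>r. r) c K (qv ^ (p * m + 1))"
    using assms(1) unfolding newton_rel_def by blast
  have "D dvd c k * dp_denom p qv k" if "k < K" for k
    by (rule newton_coeff_dvd[OF c(2)[unfolded newton_sum_def] assms(2,3) that])
  moreover have "x = (\<Sum>k<K. rep (c k * dp_denom p qv k) * w k)"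
    unfolding c(1) newton_sum_def rep.power rep_qv s.power[symmetric] newton_basis
    by (simp add: mult.assoc)
  moreover have "rep D dvd (\<Sum>k<K. rep (c k * dp_denom p qv k) * w k)"
    by (intro dvd_sum dvd_mult2 rep.dvd_hom calculation(1)) simp
  ultimately show ?thesis
    by simp
qed

end

section \<open>Comparison of denominators up to units\<close>

definition unit_multiple :: "'a::comm_ring_1 \<Rightarrow> 'a \<Rightarrow> bool" where
  "unit_multiple x y \<longleftrightarrow> (\<exists>u. u dvd 1 \<and> x = y * u)"

lemma unit_multiple_trans:
  assumes "unit_multiple x y" "unit_multiple y z"
  shows "unit_multiple x z"
proof -
  obtain u v where "u dvd 1" "v dvd 1" "x = y * u" "y = z * v"
    using assms unfolding unit_multiple_def by blast
  then have "v * u dvd 1" "x = z * (v * u)"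
    using mult_dvd_mono[of v 1 u 1] by (simp_all add: mult.assoc)
  then show ?thesis
    unfolding unit_multiple_def by blast
qed

lemma unit_multiple_prod:
  assumes "\<And>j. j \<in> A \<Longrightarrow> unit_multiple (x j) (y j)"
  shows "unit_multiple (prod x A) (prod y A)"
proof -
  obtain u where u: "\<And>j. j \<in> A \<Longrightarrow> u j dvd 1 \<and> x j = y j * u j"
    using assms unfolding unit_multiple_def by metis
  have "prod u A dvd (\<Prod>j\<in>A. 1)"
    by (rule prod_dvd_prod) (use u in blast)
  moreover have "prod x A = prod y A * prod u A"
    using u by (simp add: prod.distrib[symmetric])
  ultimately show ?thesis
    unfolding unit_multiple_def by auto
qed

lemma filt_continuous_comp:
  "filt_continuous F G f \<Longrightarrow> filt_continuous G H g \<Longrightarrow> filt_continuous F H (\<lambda>x. g (f x))"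
  unfolding filt_continuous_def by metis

lemma fps_const_plus_X_mult:
  fixes f :: "'a::comm_ring_1 fps"
  shows "f = fps_const (fps_nth f 0) + fps_X * fps_shift 1 f"
proof (rule fps_ext)
  show "fps_nth f n = fps_nth (fps_const (fps_nth f 0) + fps_X * fps_shift 1 f) n" for n
    by (cases n) simp_all
qed

context dp_completion
begin

lemma theta_q_int: "\<theta> (q_int (qv ^ k) n) = \<iota> (q_int (q' ^ k) n)"
  by (simp add: theta_qv)

text \<open>At the node \<open>q ^ (p * m + 1)\<close> the difference is a unit times
  \<open>q ^ (p ^ Suc l * m) - 1\<close>, a multiple of \<open>q - 1\<close> times the
  \<open>q\<close>-integer of \<open>p ^ Suc l\<close>, so interpolation applies. For
  \<open>l = 0\<close> the quotient is recorded explicitly because its square matters when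
  \<open>p = 2\<close>.\<close>

lemma q'_power_diff:
  obtains g where "q' ^ (p ^ l) - s qv ^ (p ^ l) = s (q_int qv (p ^ Suc l)) * g"
    "l = 0 \<Longrightarrow> g = w 1"
proof (cases "l = 0")
  case True
  then show ?thesis
    using that[of "w 1"] by (simp add: q'_def)
next
  case False
  let ?g = "\<lambda>m. (qv ^ (p ^ l) - (qv ^ (p * m + 1)) ^ (p ^ l)) * 1 :: int fps"
  have "rep (q_int qv (p ^ Suc l)) dvd (rep (qv ^ (p ^ l)) - q' ^ (p ^ l)) * 1"
  proof (rule newton_rel_dvd)
    show "newton_rel ((rep (qv ^ (p ^ l)) - q' ^ (p ^ l)) * 1) ?g"
      using newton_rel_const[of 1] by (intro newton_rel_mult_diff) simp
    show "fps_X ^ 1 * q_int qv (p ^ Suc l) dvd ?g m" for m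
    proof -
      have "fps_X * q_int qv (p ^ Suc l) = (qv ^ (p ^ Suc l) - 1 :: int fps)"
        unfolding power_diff_one_eq_q_int by (simp add: qv_def)
      also have "\<dots> dvd (qv ^ (p ^ Suc l)) ^ m - 1"
        unfolding power_diff_one_eq_q_int[of "qv ^ (p ^ Suc l)"] by simp
      also have "\<dots> dvd - (qv ^ (p ^ l) * ((qv ^ (p ^ Suc l)) ^ m - 1))"
        by simp
      also have "\<dots> = ?g m"
        by (simp add: algebra_simps flip: power_mult power_add)
      finally show ?thesis
        by simp
    qed
    show "fps_nth (q_int qv (p ^ Suc l) :: int fps) 0 \<noteq> 0"
      using prime_gt_0_nat[OF prime] by (simp add: q_int_qv_nth_0)
  qed
  then obtain h where "(rep (qv ^ (p ^ l)) - q' ^ (p ^ l)) * 1 = rep (q_int qv (p ^ Suc l)) * h"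
    by blast
  then have "q' ^ (p ^ l) - s qv ^ (p ^ l) = s (q_int qv (p ^ Suc l)) * (- h)"
    by (simp add: algebra_simps)
  then show ?thesis
    using that False by blast
qed

text \<open>Both coefficients of \<open>w 1 * w 1\<close> lie in \<open>I\<close>: one is 2 modulo
  \<open>q - 1\<close>, the other is a multiple of \<open>q - 1\<close>.\<close>

lemma w_1_square_in_I:
  assumes "p = 2"
  shows "w 1 * w 1 \<in> I"
proof -
  have "s (qv ^ p) - 1 \<in> I"
    using power_diff_one_mem[OF ideal_I s_in_I, of p] by simp
  then have "s (q_int (qv ^ p) 2) - of_nat 2 \<in> I"
    using q_int_diff_of_nat_mem[OF ideal_I, of "s (qv ^ p)" 2] by simp
  then have "(s (q_int (qv ^ p) 2) - of_nat 2) + of_nat 2 \<in> I"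
    using assms by (intro ring_module.subspace_add[OF ideal_I] of_nat_in_I) simp_all
  then have *: "s (q_int (qv ^ p) 2) \<in> I"
    by simp
  have "w 1 * w 1 = s (q_int (qv ^ p) 2) * w 2 + (s qv - 1) * (s qv * w 1)"
    using w_1_mult[of 1] by (simp add: numeral_2_eq_2 mult.assoc)
  then show ?thesis
    using * s_in_I
    by (simp only:) (intro ring_module.subspace_add[OF ideal_I] ideal_mult_right[OF ideal_I])
qed

text \<open>Modulo \<open>I\<close> every summand is 1, so the sum is
  \<open>p * (p - 1) / 2\<close>, a multiple of the odd prime \<open>p\<close>.\<close>

lemma difference_quotient_in_I:
  assumes "p \<noteq> 2" "x - 1 \<in> I" "y - 1 \<in> I"
  shows "(\<Sum>i<p. \<Sum>j<i. x ^ (i - Suc j) * y ^ j) \<in> I"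
proof -
  have "p dvd 2 * (\<Sum>i<p. i)"
    by (simp add: two_times_sum_lessThan)
  moreover have "\<not> p dvd 2"
    using assms(1) prime primes_dvd_imp_eq two_is_prime_nat by blast
  ultimately have "p dvd (\<Sum>i<p. i)"
    using prime prime_dvd_mult_iff by blast
  then have "of_nat (\<Sum>i<p. i) \<in> I"
    by (rule of_nat_in_I)
  moreover have "(\<Sum>i<p. \<Sum>j<i. x ^ (i - Suc j) * y ^ j - 1) \<in> I"
    using assms
    by (intro ring_module.subspace_sum[OF ideal_I] mult_diff_one_mem power_diff_one_mem ideal_I)
  ultimately have "(\<Sum>i<p. \<Sum>j<i. x ^ (i - Suc j) * y ^ j - 1) + of_nat (\<Sum>i<p. i) \<in> I"
    by (intro ring_module.subspace_add[OF ideal_I])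
  then show ?thesis
    by (simp add: sum_subtractf)
qed

text \<open>Here \<open>\<theta>((p)\<^bsub>q^l\<^esub>) = (p)\<^bsub>q^l\<^esub> (1 + z)\<close> with \<open>z\<close> nilpotent modulo \<open>(p, q - 1)\<close>.\<close>
lemma theta_cyclo: "unit_multiple (\<theta> (cyclo p qv l)) (\<iota> (s (cyclo p qv l)))"
proof -
  obtain g where g: "q' ^ (p ^ l) - s qv ^ (p ^ l) = s (q_int qv (p ^ Suc l)) * g"
    and g0: "l = 0 \<Longrightarrow> g = w 1"
    using q'_power_diff by blast
  define d where "d = (\<Sum>i<p. \<Sum>j<i. (s qv ^ (p ^ l)) ^ (i - Suc j) * (q' ^ (p ^ l)) ^ j)"
  define z where "z = s (q_int qv (p ^ l)) * g * d"
  have "q_int qv (p ^ Suc l) = (cyclo p qv l * q_int qv (p ^ l) :: 'w fps)"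
    using q_int_mult[of qv "p ^ l" p] by (simp add: cyclo_def mult.commute)
  then have "q_int (q' ^ (p ^ l)) p - q_int (s qv ^ (p ^ l)) p = s (cyclo p qv l) * z"
    unfolding q_int_diff g d_def[symmetric] z_def by (simp only: s.mult mult.assoc)
  moreover have "q_int (s qv ^ (p ^ l)) p = s (cyclo p qv l)"
    by (simp add: cyclo_def)
  ultimately have "q_int (q' ^ (p ^ l)) p = s (cyclo p qv l) * (1 + z)"
    by (simp add: algebra_simps del: s.cyclo)
  then have eq: "\<theta> (cyclo p qv l) = \<iota> (s (cyclo p qv l)) * \<iota> (1 + z)"
    by (metis cyclo_def iota.mult theta_q_int)
  \<comment> \<open>For \<open>l > 0\<close> the factor \<open>q_int qv (p ^ l)\<close> of
    \<open>z\<close> maps into \<open>I\<close>. For \<open>l = 0\<close> the factor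
    \<open>d\<close> lies in \<open>I\<close> when \<open>p\<close> is odd, and
    \<open>w 1 * w 1\<close> does when \<open>p = 2\<close>.\<close>
  have "z * z \<in> I"
  proof (cases "l = 0")
    case True
    then have z: "z = w 1 * d"
      by (simp add: z_def g0)
    show ?thesis
    proof (cases "p = 2")
      case True
      have "z * z = (w 1 * w 1) * (d * d)"
        by (simp add: z mult_ac)
      then show ?thesis
        using w_1_square_in_I[OF True] by (metis ideal_mult_right ideal_I)
    next
      case False
      then have "d \<in> I"
        unfolding d_def
        by (intro difference_quotient_in_I power_diff_one_mem ideal_I s_in_I q'_in_I)
      then show ?thesis
        unfolding z by (intro ring_module.subspace_scale[OF ideal_I])
    qed
  next
    case False
    then have "of_nat (p ^ l) \<in> I"
      by (intro of_nat_in_I) simp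
    then have "(q_int (s qv) (p ^ l) - of_nat (p ^ l)) + of_nat (p ^ l) \<in> I"
      using q_int_diff_of_nat_mem[OF ideal_I s_in_I] by (intro ring_module.subspace_add[OF ideal_I])
    then have "s (q_int qv (p ^ l)) \<in> I"
      by simp
    then show ?thesis
      unfolding z_def
      by (intro ring_module.subspace_scale[OF ideal_I] ideal_mult_right[OF ideal_I])
  qed
  \<comment> \<open>The product is \<open>1 - z * z\<close>, hence a unit in the completion, and
    \<open>1 + z\<close> divides it.\<close>
  then have "(1 + z) * (1 - z) - 1 \<in> I"
    using ring_module.subspace_neg[OF ideal_I, of "z * z"] by (simp add: algebra_simps)
  then have "\<iota> ((1 + z) * (1 - z)) dvd 1"
    by (rule iota_unit)
  then have "\<iota> (1 + z) dvd 1"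
    by (simp only: iota.mult dvd_mult_left)
  with eq show ?thesis
    unfolding unit_multiple_def by blast
qed

abbreviation p_parts :: "nat \<Rightarrow> 'w fps" where
  "p_parts n \<equiv> \<Prod>j<n. p_part p qv n (Suc j)"

lemma theta_p_parts: "unit_multiple (\<theta> (p_parts n)) (\<iota> (s (p_parts n)))"
  unfolding theta.prod s.prod iota.prod p_part_def
  by (intro unit_multiple_prod theta_cyclo)

text \<open>Stated for a general \<open>f\<close> because it is applied both to
  \<open>\<theta>\<close> and to the structure map. The cofactors are \<open>q\<close>-integers of
  numbers prime to \<open>p\<close>, hence units.\<close>

lemma dp_denom_unit_multiple:
  fixes f :: "'w fps \<Rightarrow> 'h"
  assumes f: "is_ring_hom f" "f qv = \<iota> x" and x: "x - 1 \<in> I"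
  shows "unit_multiple (f (dp_denom p qv n)) (f (p_parts n))"
proof -
  interpret f: ring_homo f
    by unfold_locales (rule f)
  show ?thesis
    unfolding f.prod dp_denom_def
  proof (rule unit_multiple_prod)
    fix j
    assume "j \<in> {..<n}"
    then have j: "0 < Suc j" "Suc j \<le> n"
      by simp_all
    obtain i c where c: "\<not> p dvd c"
      "q_int (qv :: 'w fps) (p * Suc j) = p_part p qv n (Suc j) * q_int (qv ^ p ^ i) c"
      by (rule q_int_eq_p_part[OF prime j])
    have "f (q_int (qv ^ p ^ i) c) = \<iota> (q_int (x ^ p ^ i) c)"
      by (simp add: f)
    then have "f (q_int (qv ^ p ^ i) c) dvd 1"
      using unit_q_int[OF power_diff_one_mem[OF ideal_I x] c(1)] by simp
    then show "unit_multiple (f (q_int qv (p * Suc j))) (f (p_part p qv n (Suc j)))"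
      unfolding unit_multiple_def c(2) by (metis f.mult)
  qed
qed

lemma theta_dp_denom: "unit_multiple (\<theta> (dp_denom p qv n)) (\<iota> (s (p_parts n)))"
  by (rule unit_multiple_trans[OF dp_denom_unit_multiple[OF theta.is_hom theta_qv q'_in_I]
        theta_p_parts])

lemma iota_s_dp_denom: "unit_multiple (\<iota> (s (dp_denom p qv n))) (\<iota> (s (p_parts n)))"
proof (rule dp_denom_unit_multiple[where f = "\<lambda>r. \<iota> (s r)" and x = "s qv"])
  show "is_ring_hom (\<lambda>r. \<iota> (s r))"
    using s.is_hom iota.is_hom by (rule is_ring_hom_comp)
qed (simp_all add: s_in_I)

section \<open>Regular elements of the completion\<close>

definition regular :: "'h \<Rightarrow> bool" where
  "regular x \<longleftrightarrow> (\<forall>h. x * h = 0 \<longrightarrow> h = 0)"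

lemma regular_mult: "regular x \<Longrightarrow> regular y \<Longrightarrow> regular (x * y)"
  unfolding regular_def by (metis mult.assoc)

lemma regular_prod: "(\<And>j. j \<in> A \<Longrightarrow> regular (x j)) \<Longrightarrow> regular (prod x A)"
proof (induction A rule: infinite_finite_induct)
  case (insert a A)
  then show ?case
    by (simp add: regular_mult)
qed (simp_all add: regular_def)

lemma regular_unit_multiple:
  assumes "unit_multiple x y" "regular y"
  shows "regular x"
proof -
  obtain u u' where u: "x = y * u" "1 = u * u'"
    using assms(1) unfolding unit_multiple_def by (auto elim!: dvdE)
  have "h = 0" if "x * h = 0" for h
  proof -
    have "y * (u * h) = 0"
      using that by (simp only: u(1) mult.assoc)
    then have "u * h = 0"
      using assms(2) unfolding regular_def by blast
    then have "u' * (u * h) = 0"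
      by simp
    moreover have "u' * (u * h) = (u * u') * h"
      by (simp only: mult_ac)
    ultimately show ?thesis
      by (simp flip: u(2))
  qed
  then show ?thesis
    by (simp add: regular_def)
qed

lemma regular_cancel: "regular x \<Longrightarrow> x * h = x * h' \<Longrightarrow> h = h'"
  unfolding regular_def by (metis eq_iff_diff_eq_0 right_diff_distrib)

lemma regular_p_parts: "regular (\<iota> (s (p_parts n)))"
  unfolding s.prod iota.prod p_part_def
  by (intro regular_prod) (use regular_cyclo in \<open>unfold regular_def, blast\<close>)

lemma regular_theta_dp_denom: "regular (\<theta> (dp_denom p qv n))"
  by (rule regular_unit_multiple[OF theta_dp_denom regular_p_parts])

lemma regular_iota_s_dp_denom: "regular (\<iota> (s (dp_denom p qv n)))"
  by (rule regular_unit_multiple[OF iota_s_dp_denom regular_p_parts])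

subsection \<open>The images of the twisted divided powers\<close>

text \<open>The Newton product \<open>dp_denom p qv n\<close> times \<open>w n\<close> with the
  roles of \<open>q\<close> and \<open>q'\<close> exchanged.\<close>

definition flipped :: "nat \<Rightarrow> 'a" where
  "flipped n = (\<Prod>k<n. s qv - q' ^ (p * k + 1))"

lemma newton_rel_flipped:
  "newton_rel (flipped n) (\<lambda>m. \<Prod>k<n. qv - (qv ^ (p * m + 1)) ^ (p * k + 1))"
proof (induction n)
  case 0
  show ?case
    using newton_rel_const[of 1] by (simp add: flipped_def)
next
  case (Suc n)
  then show ?case
    using newton_rel_mult_diff[OF Suc, of qv "p * n + 1"]
    by (simp only: flipped_def prod.lessThan_Suc rep_qv mult.commute)
qed

text \<open>At \<open>q' = q ^ (p * m + 1)\<close> the factors become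
  \<open>- q * (q ^ (p * (m + M * k)) - 1)\<close> with \<open>M = p * m + 1\<close> prime to
  \<open>p\<close>. The count of multiples in progressions applies there, and interpolation carries
  the divisibility over to the algebra.\<close>

lemma p_parts_dvd_flipped: "s (p_parts n) dvd flipped n"
proof -
  let ?D = "\<Prod>j<n. p_part p qv n (Suc j) :: int fps"
  have "rep ?D dvd flipped n"
  proof (rule newton_rel_dvd[OF newton_rel_flipped])
    show "fps_nth ?D 0 \<noteq> 0"
      by (rule prod_p_part_nth_0) (use prime_gt_0_nat[OF prime] in simp)
    fix m
    have "coprime (p * m + 1) p"
      by (rule coprimeI) (metis dvd_add_right_iff dvd_mult2)
    then have "(qv - 1) ^ n * ?D dvd (\<Prod>k<n. qv ^ (p * (m + (p * m + 1) * k)) - 1)"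
      by (rule prod_p_part_dvd_progression)
    also have "\<dots> dvd (\<Prod>k<n. qv - (qv ^ (p * m + 1)) ^ (p * k + 1))"
    proof (rule prod_dvd_prod)
      fix k
      have "(p * m + 1) * (p * k + 1) = Suc (p * (m + (p * m + 1) * k))"
        by (simp add: algebra_simps)
      then have "qv - (qv ^ (p * m + 1)) ^ (p * k + 1) =
          - qv * (qv ^ (p * (m + (p * m + 1) * k)) - 1 :: int fps)"
        unfolding power_mult[symmetric] by (simp only: power_Suc) (simp add: right_diff_distrib)
      then show "qv ^ (p * (m + (p * m + 1) * k)) - 1 dvd
          qv - (qv ^ (p * m + 1) :: int fps) ^ (p * k + 1)"
        by (metis dvd_triv_right)
    qed
    finally show "fps_X ^ n * ?D dvd (\<Prod>k<n. qv - (qv ^ (p * m + 1)) ^ (p * k + 1))"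
      by (simp add: qv_def)
  qed
  moreover have "rep ?D = s (p_parts n)"
    by (simp add: rep.prod s.prod)
  ultimately show ?thesis
    by simp
qed

text \<open>The quotient is unique by \<open>regular_theta_dp_denom\<close> and exists by
  \<open>theta_dp_denom_flip_w\<close>.\<close>

definition flip_w :: "nat \<Rightarrow> 'h" where
  "flip_w n = (SOME v. \<theta> (dp_denom p qv n) * v = \<iota> (flipped n))"

lemma theta_dp_denom_flip_w: "\<theta> (dp_denom p qv n) * flip_w n = \<iota> (flipped n)"
proof -
  obtain u u' where u: "\<theta> (dp_denom p qv n) = \<iota> (s (p_parts n)) * u" "1 = u * u'"
    using theta_dp_denom[of n] unfolding unit_multiple_def by (auto elim!: dvdE)
  obtain h where h: "flipped n = s (p_parts n) * h"
    using p_parts_dvd_flipped by blast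
  have "\<theta> (dp_denom p qv n) * (u' * \<iota> h) = (u * u') * (\<iota> (s (p_parts n)) * \<iota> h)"
    by (simp only: u(1) mult_ac)
  then have "\<theta> (dp_denom p qv n) * (u' * \<iota> h) = \<iota> (flipped n)"
    by (simp only: u(2)[symmetric] h iota.mult mult_1_left)
  then show ?thesis
    unfolding flip_w_def by (rule someI)
qed

lemma flip_w_0: "flip_w 0 = 1"
  using theta_dp_denom_flip_w[of 0] by (simp add: flipped_def)

text \<open>The mirror image of \<open>newton_step\<close>, obtained by cancelling a regular
  denominator.\<close>

lemma theta_flip_w_Suc:
  "\<theta> (q_int qv (p * Suc n)) * flip_w (Suc n) = \<iota> (s qv - q' ^ (p * n + 1)) * flip_w n"
proof (rule regular_cancel[OF regular_theta_dp_denom])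
  have "\<theta> (dp_denom p qv n) * (\<theta> (q_int qv (p * Suc n)) * flip_w (Suc n)) = \<iota> (flipped (Suc n))"
    by (simp only: theta_dp_denom_flip_w[symmetric] dp_denom_Suc theta.mult mult.assoc)
  also have "\<dots> = \<iota> (s qv - q' ^ (p * n + 1)) * \<iota> (flipped n)"
    by (simp only: flipped_def prod.lessThan_Suc iota.mult mult.commute)
  also have "\<dots> = \<theta> (dp_denom p qv n) * (\<iota> (s qv - q' ^ (p * n + 1)) * flip_w n)"
    by (simp only: theta_dp_denom_flip_w[symmetric] mult_ac)
  finally show "\<theta> (dp_denom p qv n) * (\<theta> (q_int qv (p * Suc n)) * flip_w (Suc n)) =
      \<theta> (dp_denom p qv n) * (\<iota> (s qv - q' ^ (p * n + 1)) * flip_w n)" .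
qed

definition flip_poly :: "'a \<Rightarrow> 'h" where
  "flip_poly a = (\<Sum>n | coord a n \<noteq> 0. \<theta> (coord a n) * flip_w n)"

lemma flip_poly_eq:
  assumes "finite F" "\<And>n. n \<notin> F \<Longrightarrow> coord a n = 0"
  shows "flip_poly a = (\<Sum>n\<in>F. \<theta> (coord a n) * flip_w n)"
  unfolding flip_poly_def by (rule sum.mono_neutral_left) (use assms in auto)

lemma flip_poly_add: "flip_poly (a + b) = flip_poly a + flip_poly b"
proof -
  let ?F = "{n. coord a n \<noteq> 0} \<union> {n. coord b n \<noteq> 0}"
  have F: "finite ?F"
    by (simp add: finite_coord)
  have "flip_poly (a + b) = (\<Sum>n\<in>?F. \<theta> (coord (a + b) n) * flip_w n)"
    by (rule flip_poly_eq[OF F]) (simp add: coord_add)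
  also have "\<dots> = (\<Sum>n\<in>?F. \<theta> (coord a n) * flip_w n) + (\<Sum>n\<in>?F. \<theta> (coord b n) * flip_w n)"
    by (simp add: coord_add distrib_right sum.distrib)
  also have "\<dots> = flip_poly a + flip_poly b"
    by (subst (1 2) flip_poly_eq[OF F, symmetric]) auto
  finally show ?thesis .
qed

lemma flip_poly_scale: "flip_poly (s r * a) = \<theta> r * flip_poly a"
proof -
  have "flip_poly (s r * a) = (\<Sum>n | coord a n \<noteq> 0. \<theta> (coord (s r * a) n) * flip_w n)"
    by (rule flip_poly_eq) (simp_all add: coord_scale finite_coord)
  then show ?thesis
    by (simp add: coord_scale flip_poly_def sum_distrib_left mult.assoc)
qed

lemma flip_poly_w: "flip_poly (w n) = flip_w n"
  using flip_poly_eq[of "{n}" "w n"] by (simp add: coord_w)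

lemma flip_poly_diff: "flip_poly (a - b) = flip_poly a - flip_poly b"
  using flip_poly_add[of "a - b" b] by simp

text \<open>On \<open>w n\<close> this combines \<open>newton_step\<close> with its mirror image:
  \<open>\<theta>\<close> turns the node \<open>q ^ (p * n + 1)\<close> into
  \<open>q' ^ (p * n + 1)\<close>, which cancels and leaves \<open>q\<close>.\<close>

lemma flip_poly_q': "flip_poly (q' * a) = \<iota> (s qv) * flip_poly a"
proof (induction a rule: span_induct_w)
  case (add a b)
  then show ?case
    by (simp add: distrib_left flip_poly_add)
next
  case (scale r n)
  have "q' * w n = s (q_int qv (p * Suc n)) * w (Suc n) + s (qv ^ (p * n + 1)) * w n"
    using newton_step[of n] by (simp add: algebra_simps)
  then have "flip_poly (q' * w n) =
      \<iota> (s qv - q' ^ (p * n + 1)) * flip_w n + \<iota> (q' ^ (p * n + 1)) * flip_w n"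
    by (simp only: flip_poly_add flip_poly_scale flip_poly_w theta_flip_w_Suc theta.power theta_qv
        iota.power)
  also have "\<dots> = \<iota> (s qv) * flip_w n"
    by (simp add: algebra_simps)
  finally have "flip_poly (q' * w n) = \<iota> (s qv) * flip_w n" .
  moreover have "q' * (s r * w n) = s r * (q' * w n)"
    by (simp only: mult_ac)
  ultimately show ?case
    by (simp only: flip_poly_scale flip_poly_w mult_ac)
qed

lemma flip_poly_newton_basis:
  "flip_poly ((\<Prod>i<k. q' - s (qv ^ (p * i + 1))) * a) = \<iota> (flipped k) * flip_poly a"
proof (induction k arbitrary: a)
  case (Suc k)
  have "flip_poly ((q' - s (qv ^ (p * k + 1))) * a) = \<iota> (s qv - q' ^ (p * k + 1)) * flip_poly a"
    unfolding left_diff_distrib flip_poly_diff flip_poly_q' flip_poly_scale iota.diff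
    by (simp only: theta.power theta_qv iota.power)
  then show ?case
    using Suc[of "(q' - s (qv ^ (p * k + 1))) * a"]
    by (simp only: prod.lessThan_Suc flipped_def iota.mult mult.assoc)
qed (simp add: flipped_def)

text \<open>The denominator times \<open>w n\<close> is a polynomial in \<open>q'\<close>, whose
  action is known, and the regular factor is then cancelled. This replaces a direct check of the
  product formula.\<close>

lemma flip_poly_w_mult: "flip_poly (w n * a) = flip_w n * flip_poly a"
proof (rule regular_cancel[OF regular_theta_dp_denom])
  have "\<theta> (dp_denom p qv n) * flip_poly (w n * a) = \<iota> (flipped n) * flip_poly a"
    using flip_poly_newton_basis[of n a]
    by (simp only: newton_basis mult.assoc flip_poly_scale)
  then show "\<theta> (dp_denom p qv n) * flip_poly (w n * a) =
      \<theta> (dp_denom p qv n) * (flip_w n * flip_poly a)"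
    by (simp only: theta_dp_denom_flip_w[symmetric] mult.assoc)
qed

lemma flip_poly_mult: "flip_poly (a * b) = flip_poly a * flip_poly b"
proof (induction a rule: span_induct_w)
  case (add a c)
  then show ?case
    by (simp add: distrib_right flip_poly_add)
next
  case (scale r n)
  show ?case
    by (simp only: mult.assoc flip_poly_scale flip_poly_w_mult flip_poly_w)
qed

lemma flip_poly_s: "flip_poly (s r) = \<theta> r"
  using flip_poly_scale[of r "w 0"] flip_poly_w[of 0] by (simp add: w_0 flip_w_0)

text \<open>\<open>\<theta>\<close> maps the generators \<open>p\<close> and \<open>q - 1\<close> to
  the images of \<open>p\<close> and \<open>q' - 1\<close>, both in \<open>I\<close>.\<close>

lemma flip_poly_mem_N: "x \<in> P n \<Longrightarrow> flip_poly x \<in> N n"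
proof (induction n arbitrary: x)
  case 0
  show ?case
    by (rule mem_N_0)
next
  case (Suc n)
  then obtain y z where yz: "y \<in> P n" "z \<in> P n" "x = of_nat p * y + (s qv - 1) * z"
    using ideal_power_pair by metis
  then have "x = s (of_nat p) * y + s (qv - 1) * z"
    by simp
  then have "flip_poly x = \<theta> (of_nat p) * flip_poly y + \<theta> (qv - 1) * flip_poly z"
    by (simp only: flip_poly_add flip_poly_scale)
  then have eq: "flip_poly x = \<iota> (of_nat p) * flip_poly y + \<iota> (q' - 1) * flip_poly z"
    by (simp add: theta_qv)
  show ?case
    unfolding eq using Suc.IH yz
    by (intro ring_module.subspace_add[OF is_ideal_N] iota_mult_N_Suc p_in_I q'_in_I) blast+
qed

section \<open>Extension to the completion\<close>

lemma flip_poly_extends: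
  obtains \<tau> where "is_ring_hom \<tau>" "filt_continuous N N \<tau>" "\<And>a. \<tau> (\<iota> a) = flip_poly a"
proof -
  obtain \<tau> where \<tau>: "\<And>h n a. approx h n a \<Longrightarrow> \<tau> h - flip_poly a \<in> N n"
    using extend_by_continuity[OF flip_poly_add flip_poly_mem_N] by blast
  have iota: "\<tau> (\<iota> a) = flip_poly a" for a
    using N_separated[of "\<tau> (\<iota> a) - flip_poly a"] \<tau>[OF approx_iota] by simp
  have add: "\<tau> (x + y) = \<tau> x + \<tau> y" for x y
  proof -
    have "(\<tau> x + \<tau> y) - \<tau> (x + y) \<in> N n" for n
    proof -
      obtain a b where a: "approx x n a" and b: "approx y n b"
        by (meson approx_exists)
      have "(\<tau> x - flip_poly a) + (\<tau> y - flip_poly b) - (\<tau> (x + y) - flip_poly (a + b)) \<in> N n"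
        by (intro ring_module.subspace_diff[OF is_ideal_N] ring_module.subspace_add[OF is_ideal_N]
            \<tau> approx_add a b)
      then show ?thesis
        by (simp add: flip_poly_add algebra_simps)
    qed
    then show ?thesis
      using N_separated[of "(\<tau> x + \<tau> y) - \<tau> (x + y)"] by simp
  qed
  have mult: "\<tau> (x * y) = \<tau> x * \<tau> y" for x y
  proof -
    have "\<tau> x * \<tau> y - \<tau> (x * y) \<in> N n" for n
    proof -
      obtain a b where a: "approx x n a" and b: "approx y n b"
        by (meson approx_exists)
      have "(\<tau> x - flip_poly a) * \<tau> y + flip_poly a * (\<tau> y - flip_poly b)
          - (\<tau> (x * y) - flip_poly (a * b)) \<in> N n"
        by (intro ring_module.subspace_diff[OF is_ideal_N] ring_module.subspace_add[OF is_ideal_N]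
            ideal_mult_right[OF is_ideal_N] ring_module.subspace_scale[OF is_ideal_N]
            \<tau> approx_mult a b)
      then show ?thesis
        by (simp add: flip_poly_mult algebra_simps)
    qed
    then show ?thesis
      using N_separated[of "\<tau> x * \<tau> y - \<tau> (x * y)"] by simp
  qed
  have "\<tau> 1 = 1"
    using iota[of 1] flip_poly_s[of 1] by simp
  then have "is_ring_hom \<tau>"
    by (simp add: is_ring_hom_def add mult)
  moreover have "filt_continuous N N \<tau>"
    unfolding filt_continuous_def
  proof (intro allI exI impI)
    fix x n y
    assume yx: "y - x \<in> N n"
    obtain a where a: "approx x n a"
      by (rule approx_exists)
    then have "(y - x) + (x - \<iota> a) \<in> N n"
      using yx by (intro ring_module.subspace_add[OF is_ideal_N]) (simp_all add: approx_iff)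
    then have "approx y n a"
      by (simp add: approx_iff)
    then have "(\<tau> y - flip_poly a) - (\<tau> x - flip_poly a) \<in> N n"
      by (intro ring_module.subspace_diff[OF is_ideal_N] \<tau> a)
    then show "\<tau> y - \<tau> x \<in> N n"
      by simp
  qed
  ultimately show ?thesis
    using that iota by blast
qed

subsection \<open>The flip\<close>

text \<open>The polynomials in \<open>q - 1\<close> and \<open>\<xi>\<close> over \<open>W\<close>
  lie in the equalizer \<open>S\<close> and are dense for the \<open>(p, q - 1, \<xi>)\<close>-adic
  topology, and the target is separated.\<close>

lemma eq_on_power_series:
  fixes g1 g2 :: "'w fps fps \<Rightarrow> 'h"
  assumes hom: "is_ring_hom g1" "is_ring_hom g2"
    and cont: "filt_continuous (xi_nbhd p) N g1" "filt_continuous (xi_nbhd p) N g2"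
    and eq: "\<And>a. g1 (fps_const (fps_const a)) = g2 (fps_const (fps_const a))"
      "g1 (fps_const qv) = g2 (fps_const qv)" "g1 fps_X = g2 fps_X"
  shows "g1 f = g2 f"
proof -
  interpret g1: ring_homo g1
    by unfold_locales (rule hom)
  interpret g2: ring_homo g2
    by unfold_locales (rule hom)
  define S where "S = {f. g1 f = g2 f}"
  have S_add: "x + y \<in> S" and S_mult: "x * y \<in> S" if "x \<in> S" "y \<in> S" for x y
    using that by (simp_all add: S_def)
  have S_X: "fps_X \<in> S" and S_const: "fps_const (fps_const a) \<in> S" for a
    using eq by (simp_all add: S_def)
  have "fps_const fps_X = fps_const qv - (1 :: 'w fps fps)"
    by (simp add: qv_def flip: fps_const_add)
  then have S_q: "fps_const fps_X \<in> S"
    using eq(2) by (simp add: S_def)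
  have inner: "\<exists>t y. fps_const t \<in> S \<and> r = t + fps_X ^ j * y" for j r
  proof (induction j arbitrary: r)
    case 0
    have "fps_const 0 \<in> S \<and> r = 0 + fps_X ^ 0 * r"
      by (simp add: S_def)
    then show ?case
      by blast
  next
    case (Suc j)
    obtain t y where ty: "fps_const t \<in> S" "fps_shift 1 r = t + fps_X ^ j * y"
      using Suc by blast
    have "r = fps_const (fps_nth r 0) + fps_X * (t + fps_X ^ j * y)"
      using fps_const_plus_X_mult[of r] by (simp only: ty)
    then have "r = (fps_const (fps_nth r 0) + fps_X * t) + fps_X ^ Suc j * y"
      by (simp only: power_Suc distrib_left mult.assoc add.assoc)
    moreover have "fps_const (fps_const (fps_nth r 0) + fps_X * t) \<in> S"
      unfolding fps_const_add[symmetric] fps_const_mult[symmetric]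
      by (intro S_add S_mult S_const S_q ty)
    ultimately show ?case
      by blast
  qed
  \<comment> \<open>Truncation in \<open>\<xi>\<close> at order \<open>j\<close>; every coefficient
    is truncated at order \<open>n\<close> in \<open>q - 1\<close> as well, and \<open>e\<close>
    collects these errors.\<close>
  have outer: "\<exists>t y e. t \<in> S \<and> e \<in> xi_nbhd p n \<and> f = t + fps_X ^ j * y + e" for j n f
  proof (induction j arbitrary: f)
    case 0
    have "0 \<in> S \<and> 0 \<in> xi_nbhd p n \<and> f = 0 + fps_X ^ 0 * f + 0"
      by (simp add: S_def xi_nbhd_def ring_module.subspace_0)
    then show ?case
      by blast
  next
    case (Suc j)
    have nbhd: "is_ideal (xi_nbhd p n :: 'w fps fps set)"
      by (simp add: xi_nbhd_def)
    obtain t y e where tye: "t \<in> S" "e \<in> xi_nbhd p n" "fps_shift 1 f = t + fps_X ^ j * y + e"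
      using Suc by blast
    obtain t0 y0 where t0: "fps_const t0 \<in> S" "fps_nth f 0 = t0 + fps_X ^ n * y0"
      using inner by blast
    have "f = fps_const (t0 + fps_X ^ n * y0) + fps_X * (t + fps_X ^ j * y + e)"
      using fps_const_plus_X_mult[of f] by (simp only: tye t0)
    then have "f = (fps_const t0 + fps_X * t) + fps_X ^ Suc j * y
        + (fps_const (fps_X ^ n * y0) + fps_X * e)"
      by (simp only: fps_const_add[symmetric] power_Suc distrib_left mult.assoc add_ac)
    moreover have "fps_const t0 + fps_X * t \<in> S"
      by (intro S_add S_mult S_X t0 tye)
    moreover have "fps_const (fps_X ^ n * y0) \<in> xi_nbhd p n"
    proof -
      have "fps_const (fps_X ^ n * y0) = fps_const (qv - 1) ^ n * fps_const y0"
        by (simp add: qv_def fps_const_power)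
      then show ?thesis
        unfolding xi_nbhd_def
        using power_mult_mem_ideal_power ideal_gen_base by (metis insertI1 insertI2)
    qed
    then have "fps_const (fps_X ^ n * y0) + fps_X * e \<in> xi_nbhd p n"
      using tye(2) nbhd by (intro ring_module.subspace_add ring_module.subspace_scale)
    ultimately show ?case
      by blast
  qed
  have dense: "\<exists>t \<in> S. t - f \<in> xi_nbhd p n" for n
  proof -
    obtain t y e where tye: "t \<in> S" "e \<in> xi_nbhd p n" "f = t + fps_X ^ n * y + e"
      using outer by blast
    have "fps_X ^ n * y \<in> xi_nbhd p n"
      unfolding xi_nbhd_def by (intro power_mult_mem_ideal_power ideal_gen_base) simp
    then have "- (fps_X ^ n * y + e) \<in> xi_nbhd p n"
      using tye(2) unfolding xi_nbhd_def
      by (intro ring_module.subspace_neg ring_module.subspace_add is_ideal_ideal_power)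
    moreover have "t - f = - (fps_X ^ n * y + e)"
      by (simp add: tye(3))
    ultimately show ?thesis
      using tye(1) by metis
  qed
  have "g1 f - g2 f \<in> N n" for n
  proof -
    obtain m1 m2 where m1: "\<And>y. y - f \<in> xi_nbhd p m1 \<Longrightarrow> g1 y - g1 f \<in> N n"
      and m2: "\<And>y. y - f \<in> xi_nbhd p m2 \<Longrightarrow> g2 y - g2 f \<in> N n"
      using cont unfolding filt_continuous_def by metis
    obtain t where t: "t \<in> S" "t - f \<in> xi_nbhd p (max m1 m2)"
      using dense by blast
    then have "t - f \<in> xi_nbhd p m1" "t - f \<in> xi_nbhd p m2"
      unfolding xi_nbhd_def using ideal_power_antimono by (meson max.cobounded1 max.cobounded2 subsetD)+
    then have "(g2 t - g2 f) - (g1 t - g1 f) \<in> N n"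
      by (intro ring_module.subspace_diff[OF is_ideal_N, of "g2 t - g2 f"] m1 m2)
    then show ?thesis
      using t(1) by (simp add: S_def)
  qed
  then show ?thesis
    using N_separated[of "g1 f - g2 f"] by simp
qed

context
  fixes \<kappa> :: "'w fps fps \<Rightarrow> 'h" and flip :: "'w fps fps \<Rightarrow> 'w fps fps"
  assumes canonical: "canonical_map p s w \<iota> pr \<kappa>"
    and flip: "flip_map p flip"
begin

lemma kappa_hom: "is_ring_hom \<kappa>"
  and kappa_cont: "filt_continuous (xi_nbhd p) N \<kappa>"
  and kappa_const: "\<kappa> (fps_const r) = \<iota> (s r)"
  and kappa_X: "\<kappa> fps_X = \<iota> (s (q_int qv p) * w 1)"
  using canonical by (simp_all add: canonical_map_def)

lemma flip_hom: "is_ring_hom flip"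
  and flip_cont: "filt_continuous (xi_nbhd p) (xi_nbhd p) flip"
  and flip_const: "flip (fps_const (fps_const a)) = fps_const (fps_const a)"
  and flip_qv: "flip (fps_const qv) = fps_const qv + fps_X"
  and flip_X: "flip fps_X = - fps_X"
  using flip by (simp_all add: flip_map_def)

interpretation kappa: ring_homo \<kappa>
  by unfold_locales (rule kappa_hom)

interpretation flip: ring_homo flip
  by unfold_locales (rule flip_hom)

text \<open>Twice the flip sends \<open>q\<close> to \<open>q + \<xi> - \<xi>\<close>. The
  comparison is made after \<open>\<kappa>\<close>, where agreement on generators suffices by
  \<open>eq_on_power_series\<close>.\<close>

lemma kappa_flip_flip: "\<kappa> (flip (flip f)) = \<kappa> f"
proof (rule eq_on_power_series[of "\<lambda>f. \<kappa> (flip (flip f))" \<kappa>])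
  show "is_ring_hom (\<lambda>f. \<kappa> (flip (flip f)))"
    by (rule is_ring_hom_comp[OF is_ring_hom_comp[OF flip_hom flip_hom] kappa_hom])
  show "filt_continuous (xi_nbhd p) N (\<lambda>f. \<kappa> (flip (flip f)))"
    by (rule filt_continuous_comp[OF filt_continuous_comp[OF flip_cont flip_cont] kappa_cont])
qed (simp_all add: flip_const flip_qv flip_X kappa_cont kappa_hom)

text \<open>The ring generated by the image of \<open>\<kappa>\<close> is dense up to regular denominators.\<close>
lemma identity_if_fixes_kappa:
  assumes hom: "is_ring_hom \<sigma>" and cont: "filt_continuous N N \<sigma>" and fixes_kappa: "\<And>f. \<sigma> (\<kappa> f) = \<kappa> f"
  shows "\<sigma> h = h"
proof -
  interpret sigma: ring_homo \<sigma>
    by unfold_locales (rule hom)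
  have sigma_s: "\<sigma> (\<iota> (s r)) = \<iota> (s r)" for r
    using fixes_kappa[of "fps_const r"] by (simp add: kappa_const)
  have sigma_w: "\<sigma> (\<iota> (w n)) = \<iota> (w n)" for n
  proof (rule regular_cancel[OF regular_iota_s_dp_denom])
    \<comment> \<open>Since \<open>q'\<close> comes from \<open>q + \<xi>\<close>, the Newton
      product, which is \<open>dp_denom p qv n\<close> times \<open>w n\<close>, comes from
      \<open>R[[\<xi>]]\<close> and is fixed.\<close>
    have "\<kappa> (fps_const qv + fps_X) = \<iota> q'"
      by (simp add: kappa_const kappa_X q'_def)
    then have "\<kappa> (\<Prod>i<n. (fps_const qv + fps_X) - fps_const (qv ^ (p * i + 1))) =
        \<iota> (\<Prod>i<n. q' - s (qv ^ (p * i + 1)))"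
      by (simp only: kappa.prod kappa.diff iota.prod iota.diff kappa_const)
    then have "\<sigma> (\<iota> (s (dp_denom p qv n) * w n)) = \<iota> (s (dp_denom p qv n) * w n)"
      using fixes_kappa by (metis newton_basis)
    then show "\<iota> (s (dp_denom p qv n)) * \<sigma> (\<iota> (w n)) = \<iota> (s (dp_denom p qv n)) * \<iota> (w n)"
      by (simp only: iota.mult sigma.mult sigma_s)
  qed
  have "\<sigma> (\<iota> a) = \<iota> a" for a
    by (induction a rule: span_induct_w) (simp_all add: sigma_s sigma_w)
  moreover have "filt_continuous N N (\<lambda>h. h)"
    unfolding filt_continuous_def by blast
  ultimately have "\<sigma> = (\<lambda>h. h)"
    using cont by (intro eq_of_eq_on_iota) simp_all
  then show ?thesis
    by simp
qed

text \<open>The composite fixes the image of \<open>\<kappa>\<close> by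
  \<open>kappa_flip_flip\<close>. Allowing two different maps yields involutivity and uniqueness
  from the same statement.\<close>

lemma flip_extensions_inverse:
  assumes "is_ring_hom \<tau>1" "filt_continuous N N \<tau>1" "\<And>f. \<tau>1 (\<kappa> f) = \<kappa> (flip f)"
    and "is_ring_hom \<tau>2" "filt_continuous N N \<tau>2" "\<And>f. \<tau>2 (\<kappa> f) = \<kappa> (flip f)"
  shows "\<tau>1 (\<tau>2 h) = h"
  by (rule identity_if_fixes_kappa[of "\<lambda>h. \<tau>1 (\<tau>2 h)"])
    (simp_all add: assms is_ring_hom_comp filt_continuous_comp[OF assms(5,2)] kappa_flip_flip)

lemma flip_extension_exists: "\<exists>\<tau>. flip_extension s \<iota> pr \<kappa> \<theta> flip \<tau>"
proof -
  obtain \<tau> where \<tau>: "is_ring_hom \<tau>" "filt_continuous N N \<tau>" "\<And>a. \<tau> (\<iota> a) = flip_poly a"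
    using flip_poly_extends by blast
  interpret tau: ring_homo \<tau>
    by unfold_locales (rule \<tau>)
  have tau_s: "\<tau> (\<iota> (s r)) = \<theta> r" for r
    by (simp add: \<tau>(3) flip_poly_s)
  have tau_kappa: "\<tau> (\<kappa> f) = \<kappa> (flip f)" for f
  proof (rule eq_on_power_series[of "\<lambda>f. \<tau> (\<kappa> f)" "\<lambda>f. \<kappa> (flip f)"])
    show "\<tau> (\<kappa> (fps_const (fps_const a))) = \<kappa> (flip (fps_const (fps_const a)))" for a
      by (simp add: flip_const kappa_const tau_s theta_const)
    show "\<tau> (\<kappa> (fps_const qv)) = \<kappa> (flip (fps_const qv))"
      by (simp add: flip_qv kappa_const kappa_X tau_s theta_qv q'_def)
    \<comment> \<open>On \<open>\<xi>\<close>: the image of \<open>(p)_q\<close> times that of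
      \<open>\<omega>\<close> is \<open>q - q'\<close>, which is
      \<open>- (p)_q \<omega>\<close>.\<close>
    have "\<tau> (\<kappa> fps_X) = \<theta> (q_int qv (p * Suc 0)) * flip_w (Suc 0)"
      by (simp add: kappa_X \<tau>(3) flip_poly_mult flip_poly_w flip_poly_s del: theta.q_int)
        (simp add: flip_poly_s flip: s.q_int)
    also have "\<dots> = \<iota> (s qv - q')"
      using theta_flip_w_Suc[of 0] by (simp add: flip_w_0)
    also have "\<dots> = \<kappa> (flip fps_X)"
      by (simp add: flip_X kappa_X q'_def)
    finally show "\<tau> (\<kappa> fps_X) = \<kappa> (flip fps_X)" .
  qed (simp_all add: \<tau> is_ring_hom_comp kappa_hom flip_hom
      filt_continuous_comp[OF kappa_cont \<tau>(2)] filt_continuous_comp[OF flip_cont kappa_cont])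
  have "bij \<tau>"
    using flip_extensions_inverse[OF \<tau>(1,2) tau_kappa \<tau>(1,2) tau_kappa]
    by (rule involuntory_imp_bij)
  then show ?thesis
    unfolding flip_extension_def
    by (intro exI[of _ \<tau>]) (simp add: \<tau>(1,2) tau_s tau_kappa)
qed

lemma flip_extension_inverse:
  assumes "flip_extension s \<iota> pr \<kappa> \<theta> flip \<tau>1" "flip_extension s \<iota> pr \<kappa> \<theta> flip \<tau>2"
  shows "\<tau>1 (\<tau>2 h) = h"
  by (rule flip_extensions_inverse) (use assms in \<open>simp_all add: flip_extension_def\<close>)

text \<open>Both maps are left inverse to \<open>\<tau>2\<close>, which is surjective as its own
  inverse.\<close>

lemma flip_extension_unique:
  assumes "flip_extension s \<iota> pr \<kappa> \<theta> flip \<tau>1" "flip_extension s \<iota> pr \<kappa> \<theta> flip \<tau>2"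
  shows "\<tau>1 = \<tau>2"
  using flip_extension_inverse[OF assms] flip_extension_inverse[OF assms(2,2)] by (metis ext)

end

end

theorem proposition4p6:
  fixes p :: nat
    and s :: "'w::comm_ring_1 fps \<Rightarrow> 'a::comm_ring_1"
    and w :: "nat \<Rightarrow> 'a"
    and \<iota> :: "'a \<Rightarrow> 'h::comm_ring_1"
    and pr :: "nat \<Rightarrow> 'h \<Rightarrow> 'a set"
    and \<kappa> :: "'w fps fps \<Rightarrow> 'h"
    and \<theta> :: "'w fps \<Rightarrow> 'h"
    and flip :: "'w fps fps \<Rightarrow> 'w fps fps"
  assumes "prime p"
    and "adic_complete (ideal_gen {of_nat p :: 'w})"
    and "twisted_dp_algebra p s w"
    and "adic_completion (ideal_gen {of_nat p, s (qv - 1)}) \<iota> pr"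
    and "canonical_map p s w \<iota> pr \<kappa>"
    and "taylor_map p s w \<iota> pr \<theta>"
    and "flip_map p flip"
  shows "(\<exists>!\<tau>. flip_extension s \<iota> pr \<kappa> \<theta> flip \<tau>) \<and>
         (\<forall>\<tau>. flip_extension s \<iota> pr \<kappa> \<theta> flip \<tau> \<longrightarrow> \<tau> \<circ> \<tau> = id)"
proof -
  interpret dp_completion p s w \<iota> pr \<theta>
    by unfold_locales (use assms in simp_all)
  show ?thesis
    using flip_extension_exists[OF assms(5,7)] flip_extension_unique[OF assms(5,7)]
      flip_extension_inverse[OF assms(5,7)]
    by (auto simp: fun_eq_iff)
qed

end
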